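(* For every $p\in(1,\infty)$ with $p\ne 2$ there exists $q_0=q_0(p)>1$ such that, for every integer $N>2$ and given weights $\lambda_1,\dots,\lambda_N>0$ with $\sum_{i=1}^N\lambda_i=1$, there exist compactly supported Borel probability measures $\mu_1,\dots,\mu_N$ on $\mathbb{R}^d$ with $\mu_1=f_1\,\mathcal{L}^d$, $f_1\in L^\infty(\mathbb{R}^d)$, such that the $p$-Wasserstein barycenter of $(\mu_i,\lambda_i)_{i=1,\dots,N}$ is of the form $\nu_p=g_p\,\mathcal{L}^d$ and, for $q\ge 1$, $$g_p\in L^q(\mathbb{R}^d)\quad\Longleftrightarrow\quad q<q_0.$$ In particular, $g_p\notin L^q(\mathbb{R}^d)$ for every $q\ge q_0$.
   Context: $\mathcal{L}^d$ is Lebesgue measure on $\mathbb{R}^d$. $\mathcal{P}_p(\mathbb{R}^d)$ is the set of Borel probability measures with finite $p$-th moment and $W_p(\mu,\nu)=\min_{\eta\in\Pi(\mu,\nu)}\big(\int|x-y|^p\,d\eta\big)^{1/p}$ is the $p$-Wasserstein distance ($\Pi(\mu,\nu)$ = couplings of $\mu$ and $\nu$). The $p$-Wasserstein barycenter of $(\mu_i,\lambda_i)_{i=1,\dots,N}$ is the minimizer $\nu_p$ of $\nu\mapsto\sum_{i=1}^N\lambda_iW_p^p(\mu_i,\nu)$ over $\mathcal{P}_p(\mathbb{R}^d)$ (unique when $\mu_1\ll\mathcal{L}^d$). *)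

theory Defs
  imports "HOL-Probability.Probability"
begin

definition borel_prob :: "'a::euclidean_space measure \<Rightarrow> bool" where
  "borel_prob \<mu> \<longleftrightarrow> sets \<mu> = sets borel \<and> prob_space \<mu>"

definition msupport :: "'a::euclidean_space measure \<Rightarrow> 'a set" where
  "msupport \<mu> = {x. \<forall>e>0. 0 < emeasure \<mu> (ball x e)}"

definition Pp :: "real \<Rightarrow> 'a::euclidean_space measure set" where
  "Pp p = {\<mu>. borel_prob \<mu> \<and> (\<integral>\<^sup>+ x. ennreal (norm x powr p) \<partial>\<mu>) < \<infinity>}"

definition couplings ::
    "'a::euclidean_space measure \<Rightarrow> 'a measure \<Rightarrow> ('a \<times> 'a) measure set" where
  "couplings \<mu> \<nu> = {\<eta>. borel_prob \<eta> \<and> distr \<eta> borel fst = \<mu> \<and> distr \<eta> borel snd = \<nu>}"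

(* Meaningful only on Pp p: there the set of couplings is nonempty (it contains the
   product measure), every integral below is finite, and the infimum is attained. *)
definition wasserstein :: "real \<Rightarrow> 'a::euclidean_space measure \<Rightarrow> 'a measure \<Rightarrow> real" where
  "wasserstein p \<mu> \<nu> =
     (INF \<eta>\<in>couplings \<mu> \<nu>. (\<integral>z. norm (fst z - snd z) powr p \<partial>\<eta>) powr (1 / p))"

(* Minimality only; uniqueness of the minimizer is not part of this predicate. *)
definition is_wasserstein_barycenter ::
    "real \<Rightarrow> nat \<Rightarrow> (nat \<Rightarrow> 'a::euclidean_space measure) \<Rightarrow> (nat \<Rightarrow> real) \<Rightarrow> 'a measure \<Rightarrow> bool" where
  "is_wasserstein_barycenter p N \<mu> w \<nu> \<longleftrightarrow>
     \<nu> \<in> Pp p \<and>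
     (\<forall>\<nu>'\<in>Pp p. (\<Sum>i=1..N. w i * wasserstein p (\<mu> i) \<nu> powr p)
                \<le> (\<Sum>i=1..N. w i * wasserstein p (\<mu> i) \<nu>' powr p))"

(* Membership in L^q with respect to Lebesgue measure for 1 \<le> q \<le> \<infinity>,
   in terms of a Borel representative. *)
definition in_Lq :: "ereal \<Rightarrow> ('a::euclidean_space \<Rightarrow> real) \<Rightarrow> bool" where
  "in_Lq q f \<longleftrightarrow> f \<in> borel_measurable borel \<and>
     (if q = \<infinity> then \<exists>C. AE x in lborel. \<bar>f x\<bar> \<le> C
      else (\<integral>\<^sup>+ x. ennreal (\<bar>f x\<bar> powr real_of_ereal q) \<partial>lborel) < \<infinity>)"

(* \<mu> = f L^d. The sign condition matters because ennreal truncates negative values to 0. *)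
definition has_lebesgue_density ::
    "'a::euclidean_space measure \<Rightarrow> ('a \<Rightarrow> real) \<Rightarrow> bool" where
  "has_lebesgue_density \<mu> f \<longleftrightarrow> f \<in> borel_measurable borel \<and> (\<forall>x. 0 \<le> f x) \<and>
     \<mu> = density lborel (\<lambda>x. ennreal (f x))"

end

theory Submission imports Defs begin

text \<open>
  Let \<open>\<mu> 2\<close> be the Dirac mass at \<open>z2\<close> and all later measures the Dirac mass at \<open>z3\<close>. Couplings
  with a Dirac mass are trivial, so the barycenter problem decouples pointwise: the barycenter is the image of \<open>\<mu> 1\<close> under
  the map \<open>T\<close> sending \<open>x\<close> to the minimizer of
  \<open>l |x - z|^p + a |z - z2|^p + b |z - z3|^p\<close>. With the power map \<open>pmap r x = |x|^(r-2) x\<close> the inverse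
  of \<open>T\<close> is explicit, \<open>S y = y + pmap p' (V y)\<close> with
  \<open>V y = (a/l) pmap p (y - z2) + (b/l) pmap p (y - z3)\<close> and \<open>p' = p/(p-1)\<close>.

  For \<open>p < 2\<close> the inner power map is singular at a Dirac mass where \<open>V\<close> does not vanish; for
  \<open>p > 2\<close> the outer one is singular at the zero of \<open>V\<close>. In both cases, with the singular point at the
  origin, \<open>S\<close> stretches lengths on the sphere of radius \<open>\<rho>\<close> by a factor comparable to
  \<open>\<rho>^(-\<alpha>)\<close> with \<open>0 < \<alpha> < 1\<close>. If \<open>\<mu> 1\<close> is uniform on \<open>S (cball 0 r)\<close>, the density of the
  barycenter is therefore comparable to \<open>|y|^(-\<alpha> d)\<close> on \<open>cball 0 r\<close>, which is in \<open>L^q\<close> iff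
  \<open>q < 1/\<alpha>\<close>. Two-sided Lipschitz bounds on dyadic annuli suffice for this, so no Jacobian of \<open>S\<close>
  is needed.
\<close>

section \<open>Power maps and the Bregman gap of the cost\<close>

text \<open>\<open>pmap p\<close> is the gradient of |x|^p / p. The first-order condition at the
  minimizer z for x reads l \<open>pmap p\<close> (x - z) = a \<open>pmap p\<close> (z - z2) + b
  \<open>pmap p\<close> (z - z3). Power maps with conjugate exponents invert each other, so this can
  be solved for x, though not for z: hence S is explicit and T enters only as its inverse.

  Near v \<noteq> 0 the derivative of \<open>pmap r\<close> stretches every direction by a factor of
  order |v|^(r - 2), which blows up at 0 exactly when r < 2. For p \<noteq> 2 exactly one of p and
  p' is below 2, and \<alpha> is 2 minus that exponent. Where S stretches without bound, T contracts
  and mass piles up. Since all d directions are stretched alike, the threshold q \<alpha> d < d is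
  free of d. The number of measures and their weights affect only constants and the positions of the
  Dirac masses.

  The excess of the cost over its minimum in z is a sum of Bregman divergences; the one belonging to
  z2 already yields optimality and uniqueness.\<close>

definition pmap :: "real \<Rightarrow> 'a::real_inner \<Rightarrow> 'a" where
  "pmap r x = norm x powr (r - 2) *\<^sub>R x"

lemma pmap_0 [simp]: "pmap r 0 = 0"
  by (simp add: pmap_def)

lemma norm_pmap: "norm (pmap r x) = norm x powr (r - 1)"
proof (cases "x = 0")
  case False
  then have "norm x powr (r - 2) * norm x = norm x powr (r - 2 + 1)"
    by (subst powr_add) simp
  then show ?thesis by (simp add: pmap_def)
qed (simp add: pmap_def)

lemma pmap_minus: "pmap r (- x) = - pmap r x"
  by (simp add: pmap_def)

text \<open>The hypothesis is the relation between conjugate exponents. Directions are kept, and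
  lengths are raised to r - 1 and then to s - 1.\<close>

lemma pmap_pmap:
  assumes "(r - 1) * (s - 1) = 1"
  shows "pmap s (pmap r x) = x"
proof (cases "x = 0")
  case False
  have "(norm x powr (r - 1)) powr (s - 2) * norm x powr (r - 2) = norm x powr ((r - 1) * (s - 2) + (r - 2))"
    by (simp add: powr_powr powr_add)
  also have "(r - 1) * (s - 2) + (r - 2) = 0" using assms by (simp add: algebra_simps)
  finally have "(norm x powr (r - 1)) powr (s - 2) * norm x powr (r - 2) = 1" using False by simp
  then show ?thesis by (simp add: pmap_def[of s] norm_pmap) (simp add: pmap_def)
qed simp

text \<open>The largest value sits at the outer radius for s \<ge> 0 and at the inner one for s < 0;
  the absolute value in the exponent of \<open>M\<close> covers both.\<close>

lemma powr_le_annulus: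
  fixes s :: real
  assumes "0 < \<rho>" "\<rho> \<le> t" "t \<le> M * \<rho>" "1 \<le> M"
  shows "t powr s \<le> \<rho> powr s * M powr \<bar>s\<bar>"
proof (cases "s \<ge> 0")
  case True
  have "t powr s \<le> (M * \<rho>) powr s" using assms True by (intro powr_mono2) auto
  then show ?thesis using assms True by (simp add: powr_mult mult.commute)
next
  case False
  have "t powr s \<le> \<rho> powr s" using assms False by (intro powr_mono2') auto
  also have "\<dots> \<le> \<rho> powr s * M powr \<bar>s\<bar>"
    using assms ge_one_powr_ge_zero[of M "\<bar>s\<bar>"] by (simp add: mult_le_cancel_left1)
  finally show ?thesis .
qed

lemma powr_diff_le_annulus:
  fixes s :: real
  assumes "0 < \<rho>" "1 \<le> M" "t \<in> {\<rho>..M * \<rho>}" "u \<in> {\<rho>..M * \<rho>}"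
  shows "\<bar>t powr s - u powr s\<bar> \<le> \<bar>s\<bar> * (\<rho> powr (s - 1) * M powr \<bar>s - 1\<bar>) * \<bar>t - u\<bar>"
proof -
  have "norm (t powr s - u powr s) \<le> \<bar>s\<bar> * (\<rho> powr (s - 1) * M powr \<bar>s - 1\<bar>) * norm (t - u)"
  proof (rule differentiable_bound[where S = "{\<rho>..M * \<rho>}" and f = "\<lambda>x. x powr s" and f' = "\<lambda>x h. s * x powr (s - 1) * h"])
    fix x assume x: "x \<in> {\<rho>..M * \<rho>}"
    then have "x > 0" using assms by auto
    then have "((\<lambda>x. x powr s) has_real_derivative s * x powr (s - 1)) (at x)"
      by (auto intro!: derivative_eq_intros)
    then show "((\<lambda>x. x powr s) has_derivative (\<lambda>h. s * x powr (s - 1) * h)) (at x within {\<rho>..M * \<rho>})"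
      by (simp add: has_field_derivative_def has_derivative_at_withinI)
    have "onorm (\<lambda>h. s * x powr (s - 1) * h) \<le> \<bar>s * x powr (s - 1)\<bar>"
      by (rule onorm_bound) (auto simp: abs_mult)
    also have "\<dots> \<le> \<bar>s\<bar> * (\<rho> powr (s - 1) * M powr \<bar>s - 1\<bar>)"
      using powr_le_annulus[of \<rho> x M "s - 1"] x assms by (auto simp: abs_mult intro!: mult_left_mono)
    finally show "onorm (\<lambda>h. s * x powr (s - 1) * h) \<le> \<bar>s\<bar> * (\<rho> powr (s - 1) * M powr \<bar>s - 1\<bar>)" .
  qed (use assms in auto)
  then show ?thesis by simp
qed

text \<open>Lipschitz constant of the power map on the shell with radii 1 and \<open>M\<close>: the
  first summand bounds the scalar factor, the second the variation of that factor times the length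
  of the vector.\<close>

definition pmap_const :: "real \<Rightarrow> real \<Rightarrow> real" where
  "pmap_const r M = M powr \<bar>r - 2\<bar> + \<bar>r - 2\<bar> * M powr \<bar>r - 3\<bar> * M"

lemma pmap_const_pos: "1 \<le> M \<Longrightarrow> 0 < pmap_const r M"
  unfolding pmap_const_def by (intro add_pos_nonneg) auto

lemma pmap_lipschitz_annulus:
  assumes "0 < \<rho>" "1 \<le> M" "norm x \<in> {\<rho>..M * \<rho>}" "norm y \<in> {\<rho>..M * \<rho>}"
  shows "norm (pmap r x - pmap r y) \<le> pmap_const r M * \<rho> powr (r - 2) * norm (x - y)"
proof -
  let ?s = "r - 2"
  \<comment> \<open>Split into a change of the vector and a change of the scalar factor; each is of
    order \<rho> powr (r - 2) times the distance, as homogeneity of degree r - 1 predicts.\<close>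
  have "pmap r x - pmap r y = norm x powr ?s *\<^sub>R (x - y) + (norm x powr ?s - norm y powr ?s) *\<^sub>R y"
    by (simp add: pmap_def algebra_simps)
  then have "norm (pmap r x - pmap r y) \<le> norm x powr ?s * norm (x - y) + \<bar>norm x powr ?s - norm y powr ?s\<bar> * norm y"
    by (metis norm_triangle_ineq norm_scaleR abs_of_nonneg powr_ge_zero)
  also have "\<dots> \<le> (\<rho> powr ?s * M powr \<bar>?s\<bar>) * norm (x - y)
     + (\<bar>?s\<bar> * (\<rho> powr (?s - 1) * M powr \<bar>?s - 1\<bar>) * norm (x - y)) * (M * \<rho>)"
  proof (intro add_mono mult_mono)
    show "norm x powr ?s \<le> \<rho> powr ?s * M powr \<bar>?s\<bar>"
      using assms by (intro powr_le_annulus) auto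
    have "\<bar>norm x powr ?s - norm y powr ?s\<bar> \<le> \<bar>?s\<bar> * (\<rho> powr (?s - 1) * M powr \<bar>?s - 1\<bar>) * \<bar>norm x - norm y\<bar>"
      using assms by (intro powr_diff_le_annulus) auto
    also have "\<dots> \<le> \<bar>?s\<bar> * (\<rho> powr (?s - 1) * M powr \<bar>?s - 1\<bar>) * norm (x - y)"
      by (intro mult_left_mono norm_triangle_ineq3) auto
    finally show "\<bar>norm x powr ?s - norm y powr ?s\<bar> \<le> \<bar>?s\<bar> * (\<rho> powr (?s - 1) * M powr \<bar>?s - 1\<bar>) * norm (x - y)" .
  qed (use assms in auto)
  also have "\<rho> powr ?s = \<rho> powr (?s - 1) * \<rho>"
    using assms powr_add[of \<rho> "?s - 1" 1] by simp
  finally show ?thesis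
    using \<open>\<rho> powr ?s = \<rho> powr (?s - 1) * \<rho>\<close> by (simp add: pmap_const_def algebra_simps)
qed

text \<open>\<open>pmap (r / (r - 1))\<close> inverts \<open>pmap r\<close>, so its Lipschitz bound gives the lower bound for \<open>pmap r\<close>.\<close>

lemma pmap_expand_annulus:
  assumes "0 < \<rho>" "1 \<le> M" "1 < r" "norm x \<in> {\<rho>..M * \<rho>}" "norm y \<in> {\<rho>..M * \<rho>}"
  shows "\<rho> powr (r - 2) / pmap_const (r / (r - 1)) (M powr (r - 1)) * norm (x - y) \<le> norm (pmap r x - pmap r y)"
proof -
  let ?s = "r / (r - 1)" and ?M = "M powr (r - 1)" and ?\<rho> = "\<rho> powr (r - 1)"
  have rs: "(r - 1) * (?s - 1) = 1" using assms by (simp add: field_simps)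
  have "norm (pmap ?s (pmap r x) - pmap ?s (pmap r y)) \<le> pmap_const ?s ?M * ?\<rho> powr (?s - 2) * norm (pmap r x - pmap r y)"
  proof (rule pmap_lipschitz_annulus)
    show "1 \<le> ?M" using assms by (intro ge_one_powr_ge_zero) auto
    have *: "norm (pmap r z) \<in> {?\<rho>..?M * ?\<rho>}" if "norm z \<in> {\<rho>..M * \<rho>}" for z :: 'a
    proof -
      have "norm z powr (r - 1) \<le> (M * \<rho>) powr (r - 1)" using that assms by (intro powr_mono2) auto
      moreover have "\<rho> powr (r - 1) \<le> norm z powr (r - 1)" using that assms by (intro powr_mono2) auto
      ultimately show ?thesis using assms by (simp add: norm_pmap powr_mult)
    qed
    show "norm (pmap r x) \<in> {?\<rho>..?M * ?\<rho>}" "norm (pmap r y) \<in> {?\<rho>..?M * ?\<rho>}" using * assms by auto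
  qed (use assms in auto)
  moreover have "?\<rho> powr (?s - 2) = 1 / \<rho> powr (r - 2)"
  proof -
    have "(r - 1) * (?s - 2) = - (r - 2)" using rs by (simp add: algebra_simps)
    then show ?thesis by (simp only: powr_powr powr_minus_divide)
  qed
  ultimately have "norm (x - y) \<le> pmap_const ?s ?M / \<rho> powr (r - 2) * norm (pmap r x - pmap r y)"
    by (simp add: pmap_pmap rs)
  moreover have "0 < pmap_const ?s ?M" using assms by (intro pmap_const_pos ge_one_powr_ge_zero) auto
  ultimately show ?thesis using assms by (simp add: field_simps)
qed

text \<open>Away from 0 this is a composition of continuous maps. At 0 the scalar factor may blow
  up, but the norm of the image is norm x powr (r - 1) with a positive exponent.\<close>

lemma continuous_pmap:
  assumes "1 < r"
  shows "continuous_on UNIV (pmap r :: 'a::real_inner \<Rightarrow> 'a)"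
  unfolding continuous_on_eq_continuous_at[OF open_UNIV]
proof
  fix x :: 'a
  show "isCont (pmap r) x"
  proof (cases "x = 0")
    case False
    then show ?thesis unfolding pmap_def by (intro continuous_intros) auto
  next
    case True
    have "((\<lambda>x::'a. norm x powr (r - 1)) \<longlongrightarrow> 0 powr (r - 1)) (at 0)"
      using assms by (intro tendsto_powr' tendsto_norm_zero tendsto_ident_at tendsto_const) auto
    then have "((\<lambda>x::'a. norm (pmap r x)) \<longlongrightarrow> 0) (at 0)" by (simp add: norm_pmap)
    then show ?thesis using True by (simp add: isCont_def tendsto_norm_zero_iff)
  qed
qed

lemma continuous_on_pmap [continuous_intros]:
  assumes "1 < r" "continuous_on A f"
  shows "continuous_on A (\<lambda>x. pmap r (f x))"
  using continuous_on_compose2[OF continuous_pmap[OF assms(1)] assms(2)] by auto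

lemma continuous_on_norm_powr:
  assumes "0 < p" "continuous_on A f"
  shows "continuous_on A (\<lambda>x. norm (f x) powr p)"
  using assms by (intro continuous_on_powr' continuous_on_norm continuous_on_const) auto

section \<open>Strict convexity of the cost and its Bregman divergence\<close>

text \<open>The tangent of t powr p at 1: by the mean value theorem the slope is below p to the left
  of 1 and above p to the right.\<close>

lemma Bernoulli_powr_strict:
  fixes u p :: real
  assumes "1 < p" "0 \<le> u" "u \<noteq> 1"
  shows "1 + p * (u - 1) < u powr p"
proof (cases "u = 0")
  case False
  have d: "((\<lambda>t. t powr p) has_real_derivative p * t powr (p - 1)) (at t)" if "t > 0" for t
    using that by (auto intro!: derivative_eq_intros)
  consider "u < 1" | "u > 1" using assms by linarith
  then show ?thesis
  proof cases
    case 1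
    obtain z where z: "u < z" "z < 1" "1 powr p - u powr p = (1 - u) * (p * z powr (p - 1))"
      using MVT2[OF 1, of "\<lambda>t. t powr p" "\<lambda>t. p * t powr (p - 1)"] d False assms by auto
    have "z powr (p - 1) < 1 powr (p - 1)" using z assms by (intro powr_less_mono2) auto
    then have "(1 - u) * (p * z powr (p - 1)) < (1 - u) * (p * 1)"
      using 1 assms by (intro mult_strict_left_mono) auto
    then show ?thesis using z by (simp add: algebra_simps)
  next
    case 2
    obtain z where z: "1 < z" "z < u" "u powr p - 1 powr p = (u - 1) * (p * z powr (p - 1))"
      using MVT2[OF 2, of "\<lambda>t. t powr p" "\<lambda>t. p * t powr (p - 1)"] d by auto
    have "1 powr (p - 1) < z powr (p - 1)" using z assms by (intro powr_less_mono2) auto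
    then have "(u - 1) * (p * 1) < (u - 1) * (p * z powr (p - 1))"
      using 2 assms by (intro mult_strict_left_mono) auto
    then show ?thesis using z by (simp add: algebra_simps)
  qed
qed (use assms in auto)

text \<open>The Bregman divergence of |x|^p: the excess at \<open>z\<close> over the tangent at the
  base point \<open>w\<close>, whose gradient is p times \<open>pmap p w\<close>. The base point is
  the first argument.\<close>

definition breg :: "real \<Rightarrow> 'a::real_inner \<Rightarrow> 'a \<Rightarrow> real" where
  "breg p w z = norm z powr p - norm w powr p - p * (pmap p w \<bullet> (z - w))"

lemma breg_self [simp]: "breg p w w = 0"
  by (simp add: breg_def)

text \<open>With s and t the norms of \<open>w\<close> and \<open>z\<close>, Cauchy-Schwarz reduces
  the claim to the scalar tangent inequality for t / s, which is strict unless s = t. For s = t the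
  inner product itself falls short of s^2 by half the squared distance.\<close>

lemma breg_pos:
  fixes w z :: "'a::real_inner"
  assumes "1 < p" "z \<noteq> w"
  shows "0 < breg p w z"
proof (cases "w = 0")
  case True
  then show ?thesis using assms by (simp add: breg_def)
next
  case False
  define s where "s = norm w"
  define t where "t = norm z"
  have s: "s > 0" and t: "t \<ge> 0" using False by (auto simp: s_def t_def)
  have pp: "s powr p = s powr (p - 2) * s ^ 2"
    using s powr_add[of s "p - 2" 2] by simp
  have ww: "pmap p w \<bullet> w = s powr p"
    unfolding pp by (simp add: pmap_def dot_square_norm s_def)
  have eq: "breg p w z = t powr p + (p - 1) * s powr p - p * s powr (p - 2) * (w \<bullet> z)"
    by (simp add: breg_def inner_diff_right ww s_def[symmetric] t_def[symmetric])
       (simp add: pmap_def s_def[symmetric] algebra_simps)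
  have cs: "w \<bullet> z \<le> s * t" unfolding s_def t_def by (rule norm_cauchy_schwarz)
  show ?thesis
  proof (cases "s = t")
    case True
    have "w \<bullet> z = s ^ 2 - (norm (w - z))\<^sup>2 / 2"
      unfolding dot_norm_neg s_def[symmetric] t_def[symmetric] True[symmetric] by (simp add: field_simps)
    moreover have "0 < (norm (w - z))\<^sup>2" using assms by simp
    ultimately have "w \<bullet> z < s ^ 2" by linarith
    then have "p * s powr (p - 2) * (w \<bullet> z) < p * s powr (p - 2) * s ^ 2"
      using s assms by (intro mult_strict_left_mono) auto
    then have "p * s powr (p - 2) * (w \<bullet> z) < p * s powr p" unfolding pp by simp
    then show ?thesis unfolding eq True[symmetric] by (simp add: algebra_simps)
  next
    case False
    have "1 + p * (t / s - 1) < (t / s) powr p"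
      using assms s t False by (intro Bernoulli_powr_strict) auto
    then have "s powr p * (1 + p * (t / s - 1)) < s powr p * (t / s) powr p"
      using s by simp
    also have "s powr p * (t / s) powr p = t powr p"
      using s t by (simp add: powr_divide)
    finally have "s powr p + p * (s powr p / s * t - s powr p) < t powr p"
      by (simp add: algebra_simps)
    moreover have "s powr p / s = s powr (p - 2) * s" using s by (simp add: pp power2_eq_square)
    moreover have "p * s powr (p - 2) * (w \<bullet> z) \<le> p * s powr (p - 2) * (s * t)"
      using cs assms by (intro mult_left_mono) auto
    ultimately show ?thesis by (simp add: eq algebra_simps)
  qed
qed

lemma breg_nonneg: "1 < p \<Longrightarrow> 0 \<le> breg p w z"
  by (metis breg_pos breg_self less_imp_le order_refl)

text \<open>By the three-point identity the increment is another divergence plus a nonnegative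
  multiple of the gradient increment paired with \<open>u\<close>. That pairing is nonnegative:
  times p, it is the sum of the divergences in both directions.\<close>

lemma breg_mono_ray:
  assumes "1 < p" "1 \<le> t"
  shows "breg p w (w + u) \<le> breg p w (w + t *\<^sub>R u)"
proof -
  have 1: "breg p w (w + t *\<^sub>R u) - breg p w (w + u)
      = breg p (w + u) (w + t *\<^sub>R u) + p * (t - 1) * ((pmap p (w + u) - pmap p w) \<bullet> u)"
    by (simp add: breg_def algebra_simps inner_diff_left inner_diff_right inner_add_right)
  have "breg p w (w + u) + breg p (w + u) w = p * ((pmap p (w + u) - pmap p w) \<bullet> u)"
    by (simp add: breg_def algebra_simps inner_diff_left inner_diff_right inner_add_right)
  then have "0 \<le> (pmap p (w + u) - pmap p w) \<bullet> u"
    using breg_nonneg[OF assms(1), of w "w + u"] breg_nonneg[OF assms(1), of "w + u" w] assms(1)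
    by (metis add_nonneg_nonneg zero_le_mult_iff not_less not_one_less_zero order_less_trans zero_less_one)
  then show ?thesis using 1 assms breg_nonneg[OF assms(1), of "w + u" "w + t *\<^sub>R u"]
    by (smt (verit) mult_nonneg_nonneg)
qed

text \<open>Compactness gives a positive minimum over base points in the ball and displacements of
  length \<epsilon>; monotonicity along rays carries it to the unbounded set of larger
  displacements.\<close>

lemma breg_unif_pos:
  assumes "1 < p" "0 < \<epsilon>"
  shows "\<exists>\<delta>>0. \<forall>w\<in>cball (c::'a::euclidean_space) r. \<forall>z. \<epsilon> \<le> norm (z - w) \<longrightarrow> \<delta> \<le> breg p w z"
proof -
  let ?K = "cball c r \<times> sphere (0::'a) \<epsilon>"
  define F where "F = (\<lambda>(w, u::'a). breg p w (w + u))"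
  have K: "compact ?K" by (intro compact_Times) auto
  have cont: "continuous_on ?K F"
    unfolding F_def breg_def case_prod_unfold using assms
    by (intro continuous_on_diff continuous_on_norm_powr continuous_on_mult continuous_on_inner
        continuous_on_pmap continuous_on_add continuous_on_const continuous_on_fst continuous_on_snd continuous_on_id) auto
  show ?thesis
  proof (cases "?K = {}")
    case True
    have "sphere (0::'a) \<epsilon> \<noteq> {}" using assms by simp
    with True have "cball c r = {}" by auto
    then show ?thesis using zero_less_one by (intro exI[of _ 1]) blast
  next
    case False
    obtain k where k: "k \<in> ?K" "\<And>x. x \<in> ?K \<Longrightarrow> F k \<le> F x"
      using continuous_attains_inf[OF K False cont] by auto
    obtain w0 u0 where wu: "k = (w0, u0)" "norm u0 = \<epsilon>" using k(1) by (cases k) auto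
    then have "u0 \<noteq> 0" using assms by auto
    then have "0 < F k" using breg_pos[OF assms(1), of "w0 + u0" w0] wu by (simp add: F_def)
    moreover have "F k \<le> breg p w z" if "w \<in> cball c r" "\<epsilon> \<le> norm (z - w)" for w z
    proof -
      define u where "u = (\<epsilon> / norm (z - w)) *\<^sub>R (z - w)"
      have nz: "norm (z - w) > 0" using that assms by linarith
      have "norm u = \<epsilon>" using nz assms by (simp add: u_def)
      then have "F k \<le> breg p w (w + u)" using k(2)[of "(w, u)"] that by (simp add: F_def)
      also have "\<dots> \<le> breg p w (w + (norm (z - w) / \<epsilon>) *\<^sub>R u)"
        using assms that by (intro breg_mono_ray) auto
      also have "w + (norm (z - w) / \<epsilon>) *\<^sub>R u = z" using nz assms by (simp add: u_def)
      finally show ?thesis .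
    qed
    ultimately show ?thesis by blast
  qed
qed

text \<open>The two sides differ by half the product of the increments of norm^(r - 2) and norm^2,
  both nondecreasing in the norm for r \<ge> 2.\<close>

lemma pmap_inner_ge:
  fixes x y :: "'a::real_inner"
  assumes "2 \<le> r"
  shows "(norm x powr (r - 2) + norm y powr (r - 2)) / 2 * (norm (x - y))\<^sup>2 \<le> (pmap r x - pmap r y) \<bullet> (x - y)"
proof -
  let ?a = "norm x powr (r - 2)" and ?b = "norm y powr (r - 2)"
  have "(pmap r x - pmap r y) \<bullet> (x - y) = (?a + ?b) / 2 * (norm (x - y))\<^sup>2
      + (?a - ?b) * ((norm x)\<^sup>2 - (norm y)\<^sup>2) / 2"
    by (simp add: pmap_def power2_norm_eq_inner inner_diff_left inner_diff_right inner_commute algebra_simps)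
       (simp add: field_simps)
  moreover have "0 \<le> (?a - ?b) * ((norm x)\<^sup>2 - (norm y)\<^sup>2)"
  proof (cases "norm x \<le> norm y")
    case True
    then have "?a \<le> ?b" "(norm x)\<^sup>2 \<le> (norm y)\<^sup>2" using assms by (auto intro!: powr_mono2 power_mono)
    then show ?thesis by (simp add: mult_nonpos_nonpos)
  next
    case False
    then have "?b \<le> ?a" "(norm y)\<^sup>2 \<le> (norm x)\<^sup>2" using assms by (auto intro!: powr_mono2 power_mono)
    then show ?thesis by simp
  qed
  ultimately show ?thesis by linarith
qed

section \<open>Lebesgue measure of Lipschitz images\<close>

lemma emeasure_ball_scale:
  fixes x y :: "'a::euclidean_space"
  assumes "0 \<le> M" "0 \<le> s"
  shows "emeasure lborel (cball y (M * s)) = ennreal (M ^ DIM('a)) * emeasure lborel (ball x s)"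
  using assms by (simp add: emeasure_cball emeasure_ball power_mult_distrib mult.left_commute flip: ennreal_mult)

text \<open>The disjoint balls of the Vitali theorem are indexed by a countable set of pairs, so
  subadditivity is stated with an integral over \<open>count_space\<close>.\<close>

lemma emeasure_UN_le_nn_integral:
  assumes C: "countable C" and F: "\<And>i. i \<in> C \<Longrightarrow> F i \<in> sets M"
  shows "emeasure M (\<Union>i\<in>C. F i) \<le> (\<integral>\<^sup>+ i. emeasure M (F i) \<partial>count_space C)"
proof (cases "C = {}")
  case False
  have "emeasure M (\<Union>i\<in>C. F i) = (\<integral>\<^sup>+ x. indicator (\<Union>i\<in>C. F i) x \<partial>M)"
    using assms by (intro nn_integral_indicator[symmetric]) auto
  also have "\<dots> \<le> (\<integral>\<^sup>+ x. (\<integral>\<^sup>+ i. indicator (F i) x \<partial>count_space C) \<partial>M)"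
  proof (intro nn_integral_mono)
    fix x
    show "indicator (\<Union>i\<in>C. F i) x \<le> (\<integral>\<^sup>+ i. indicator (F i) x \<partial>count_space C)"
    proof (cases "\<exists>i\<in>C. x \<in> F i")
      case True
      then obtain i where i: "i \<in> C" "x \<in> F i" by auto
      have "(1::ennreal) = (\<integral>\<^sup>+ j. indicator {i} j \<partial>count_space C)"
        using i by (subst nn_integral_indicator) auto
      also have "\<dots> \<le> (\<integral>\<^sup>+ i. indicator (F i) x \<partial>count_space C)"
        using i by (intro nn_integral_mono) (auto simp: indicator_def)
      finally show ?thesis using True by (simp add: indicator_def)
    qed auto
  qed
  also have "\<dots> = (\<integral>\<^sup>+ i. emeasure M (F i) \<partial>count_space C)"
    using assms by (subst nn_integral_count_space_nn_integral) (auto intro!: nn_integral_cong)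
  finally show ?thesis .
qed simp

text \<open>Disjoint balls centred in \<open>E\<close>, inside an open set of nearly the same
  measure, cover \<open>E\<close> up to a null set. The part of \<open>E\<close> in a ball of radius
  s is sent into a ball of radius M s, and the null remainder to a null set. The centres must lie in
  \<open>E\<close>, where the Lipschitz bound holds.\<close>

lemma lipschitz_emeasure_image_le:
  fixes f :: "'a::euclidean_space \<Rightarrow> 'a"
  assumes lip: "M-lipschitz_on E f" and E: "E \<in> sets borel" and fE: "f ` E \<in> sets borel"
  shows "emeasure lborel (f ` E) \<le> ennreal (M ^ DIM('a)) * emeasure lborel E"
proof (rule ennreal_le_epsilon)
  fix e :: real assume e: "e > 0" 
  have M: "0 \<le> M" using lipschitz_on_nonneg[OF lip] .
  let ?c = "ennreal (M ^ DIM('a))"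
  \<comment> \<open>The error of the outer open set gets multiplied by M^d; the summand 1 keeps the
    denominator positive when M = 0.\<close>
  define e' where "e' = e / (M ^ DIM('a) + 1)"
  have e': "e' > 0" using e M by (simp add: e'_def add_nonneg_pos)
  have "E \<in> sets lebesgue" using E by auto
  then obtain U where U: "open U" "E \<subseteq> U" "emeasure lebesgue (U - E) < ennreal e'"
    using sets_lebesgue_outer_open[OF _ e'] by metis
  have EU: "emeasure lborel U \<le> emeasure lborel E + ennreal e'"
  proof -
    have "emeasure lborel U = emeasure lborel E + emeasure lborel (U - E)"
      using U E by (subst plus_emeasure) (auto intro!: arg_cong[where f = "emeasure lborel"])
    moreover have "emeasure lborel (U - E) \<le> ennreal e'"
      using U E by (simp add: emeasure_completion)
    ultimately show ?thesis by (simp add: add_left_mono)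
  qed
  let ?K = "{(x, s). x \<in> E \<and> 0 < s \<and> ball x s \<subseteq> U}"
  have cov: "\<exists>i. i \<in> ?K \<and> x \<in> ball (fst i) (snd i) \<and> snd i < d" if "x \<in> E" "0 < d" for x d
  proof -
    obtain k where k: "k > 0" "ball x k \<subseteq> U" using U \<open>x \<in> E\<close> by (meson openE subsetD)
    have "ball x (min k (d / 2)) \<subseteq> ball x k" by (intro subset_ball) auto
    then have "ball x (min k (d / 2)) \<subseteq> U" using k by blast
    then show ?thesis using that k by (intro exI[of _ "(x, min k (d / 2))"]) auto
  qed
  obtain C where C: "countable C" "C \<subseteq> ?K"
     "pairwise (\<lambda>i j. disjnt (ball (fst i) (snd i)) (ball (fst j) (snd j))) C"
     "negligible (E - (\<Union>i \<in> C. ball (fst i) (snd i)))"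
    using Vitali_covering_theorem_balls[of E ?K fst snd, OF cov] by blast
  let ?N = "E - (\<Union>i \<in> C. ball (fst i) (snd i))"
  let ?B = "\<Union>i\<in>C. cball (f (fst i)) (M * snd i)"
  have "negligible (f ` ?N)"
  proof (rule negligible_locally_Lipschitz_image[OF _ C(4)])
    fix x assume "x \<in> ?N"
    then have "\<forall>y\<in>?N \<inter> UNIV. norm (f y - f x) \<le> M * norm (y - x)"
      using lipschitz_onD[OF lip] by (auto simp: dist_norm)
    then show "\<exists>T B. open T \<and> x \<in> T \<and> (\<forall>y\<in>?N \<inter> T. norm (f y - f x) \<le> B * norm (y - x))"
      by blast
  qed simp
  then have N0: "emeasure lebesgue (f ` ?N) = 0" "f ` ?N \<in> sets lebesgue"
    by (auto simp: negligible_iff_null_sets null_sets_def)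
  have sub: "f ` E \<subseteq> f ` ?N \<union> ?B"
  proof
    fix z assume "z \<in> f ` E"
    then obtain x where x: "x \<in> E" "z = f x" by auto
    show "z \<in> f ` ?N \<union> ?B"
    proof (cases "x \<in> ?N")
      case False
      then obtain i where i: "i \<in> C" "x \<in> ball (fst i) (snd i)" using x by auto
      then have "fst i \<in> E" using C by (auto simp: case_prod_unfold)
      then have "dist (f (fst i)) (f x) \<le> M * dist (fst i) x"
        using lipschitz_onD[OF lip] x by blast
      also have "\<dots> \<le> M * snd i" using i M by (intro mult_left_mono) auto
      finally show ?thesis using x i by auto
    qed (use x in auto)
  qed
  have Bs: "?B \<in> sets borel" using C by (intro sets.countable_UN') auto
  \<comment> \<open>The image of the uncovered remainder is only known to be Lebesgue measurable, so
    the estimate runs in the completed measure.\<close>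
  have "emeasure lborel (f ` E) = emeasure lebesgue (f ` E)" using fE by simp
  also have "\<dots> \<le> emeasure lebesgue (f ` ?N \<union> ?B)"
    using Bs N0 by (intro emeasure_mono[OF sub]) auto
  also have "\<dots> \<le> emeasure lebesgue (f ` ?N) + emeasure lebesgue ?B"
    using Bs N0 by (intro emeasure_subadditive) auto
  also have "\<dots> = emeasure lborel ?B" using N0 Bs by simp
  also have "\<dots> \<le> (\<integral>\<^sup>+ i. emeasure lborel (cball (f (fst i)) (M * snd i)) \<partial>count_space C)"
    using C(1) by (intro emeasure_UN_le_nn_integral) auto
  also have "\<dots> = (\<integral>\<^sup>+ i. ?c * emeasure lborel (ball (fst i) (snd i)) \<partial>count_space C)"
    using C M by (intro nn_integral_cong emeasure_ball_scale) (auto simp: case_prod_unfold)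
  also have "\<dots> = ?c * (\<integral>\<^sup>+ i. emeasure lborel (ball (fst i) (snd i)) \<partial>count_space C)"
    by (intro nn_integral_cmult) auto
  also have "(\<integral>\<^sup>+ i. emeasure lborel (ball (fst i) (snd i)) \<partial>count_space C)
     = emeasure lborel (\<Union>i\<in>C. ball (fst i) (snd i))"
    using C(3) by (intro emeasure_UN_countable[symmetric] C) (auto simp: disjoint_family_on_def pairwise_def disjnt_def)
  also have "\<dots> \<le> emeasure lborel U"
    using C(2) U by (intro emeasure_mono) (auto simp: case_prod_unfold)
  also have "?c * emeasure lborel U \<le> ?c * (emeasure lborel E + ennreal e')"
    by (intro mult_left_mono EU) auto
  also have "\<dots> = ?c * emeasure lborel E + ennreal (M ^ DIM('a) * e')"
    using M e' by (simp add: distrib_left ennreal_mult)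
  also have "\<dots> \<le> ?c * emeasure lborel E + ennreal e"
  proof (intro add_left_mono ennreal_leI)
    have "(M ^ DIM('a) + 1) * e' = e" using M by (simp add: e'_def add_nonneg_pos less_imp_neq[symmetric])
    then show "M ^ DIM('a) * e' \<le> e" using e' by (simp add: algebra_simps)
  qed
  finally show "emeasure lborel (f ` E) \<le> ?c * emeasure lborel E + ennreal e"
    by (simp add: mult_left_mono)
qed

section \<open>Densities with a radial singularity\<close>

text \<open>Closed on the outer side and open on the inner one, so that the shells are disjoint and
  fill the punctured ball.\<close>

definition annulus :: "real \<Rightarrow> nat \<Rightarrow> 'a::euclidean_space set" where
  "annulus r k = cball 0 (r / 2 ^ k) - cball 0 (r / 2 ^ Suc k)"

lemma annulus_borel [measurable]: "annulus r k \<in> sets borel"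
  by (simp add: annulus_def)

lemma emeasure_annulus:
  fixes r :: real
  assumes "0 < r"
  shows "emeasure lborel (annulus r k :: 'a::euclidean_space set)
    = ennreal (unit_ball_vol DIM('a) * r ^ DIM('a) * (1 - (1/2) ^ DIM('a)) * ((1/2) ^ DIM('a)) ^ k)"
proof -
  let ?d = "DIM('a)"
  have "cball 0 (r / 2 ^ Suc k) \<subseteq> (cball 0 (r / 2 ^ k) :: 'a set)"
    using assms by (intro subset_cball) (simp add: field_simps)
  then have "emeasure lborel (annulus r k :: 'a set)
    = emeasure lborel (cball 0 (r / 2 ^ k) :: 'a set) - emeasure lborel (cball 0 (r / 2 ^ Suc k) :: 'a set)"
    unfolding annulus_def using emeasure_lborel_cball_finite[of "0::'a" "r / 2 ^ Suc k"]
    by (intro emeasure_Diff) (auto simp: less_top)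
  also have "\<dots> = ennreal (unit_ball_vol ?d * (r / 2 ^ k) ^ ?d - unit_ball_vol ?d * (r / 2 ^ Suc k) ^ ?d)"
    using assms by (simp add: emeasure_cball ennreal_minus)
  also have "unit_ball_vol ?d * (r / 2 ^ k) ^ ?d - unit_ball_vol ?d * (r / 2 ^ Suc k) ^ ?d
    = unit_ball_vol ?d * r ^ ?d * (1 - (1/2) ^ ?d) * ((1/2) ^ ?d) ^ k"
    by (simp add: power_divide power_mult_distrib power_mult[symmetric] mult.commute field_simps)
  finally show ?thesis .
qed

lemma disjoint_annulus:
  assumes "0 < r"
  shows "disjoint_family (annulus r :: nat \<Rightarrow> 'a::euclidean_space set)"
proof -
  have "annulus r i \<inter> annulus r j = ({} :: 'a set)" if "i < j" for i j
  proof -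
    have "(2::real) ^ Suc i \<le> 2 ^ j" using that by (intro power_increasing) auto
    then have "r / 2 ^ j \<le> r / 2 ^ Suc i" using assms by (intro divide_left_mono) auto
    then show ?thesis by (auto simp: annulus_def)
  qed
  then show ?thesis unfolding disjoint_family_on_def by (metis Int_commute linorder_neqE_nat)
qed

lemma Union_annulus:
  assumes "0 < r"
  shows "(\<Union>k. annulus r k) = cball (0::'a::euclidean_space) r - {0}"
proof (intro equalityI subsetI)
  fix y :: 'a assume "y \<in> (\<Union>k. annulus r k)"
  then obtain k where k: "norm y \<le> r / 2 ^ k" "r / 2 ^ Suc k < norm y" by (auto simp: annulus_def)
  have "r / 2 ^ k \<le> r / 1" using assms by (intro divide_left_mono) auto
  moreover have "0 < r / 2 ^ Suc k" using assms by simp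
  ultimately show "y \<in> cball 0 r - {0}" using k by auto
next
  fix y :: 'a assume y: "y \<in> cball 0 r - {0}"
  then have y': "0 < norm y" "norm y \<le> r" by auto
  obtain n where n: "(1/2) ^ n < norm y / r"
    using real_arch_pow_inv[of "norm y / r" "1/2"] y' assms by auto
  let ?P = "\<lambda>n. r / 2 ^ n < norm y"
  have Pn: "?P n" using n assms by (simp add: field_simps power_divide)
  \<comment> \<open>Index of the first dyadic radius below norm y. It is not 0, and its predecessor
    is the index of the shell.\<close>
  define m where "m = (LEAST n. ?P n)"
  have m: "?P m" unfolding m_def by (rule LeastI[of ?P, OF Pn])
  have "m \<noteq> 0" using m y' by (intro notI) simp
  then obtain k where k: "m = Suc k" by (cases m) auto
  have "\<not> ?P k" using not_less_Least[of k ?P] k by (simp add: m_def)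
  then have "y \<in> annulus r k" using m k by (auto simp: annulus_def)
  then show "y \<in> (\<Union>k. annulus r k)" by blast
qed

section \<open>Densities: from bounds on sets to bounds almost everywhere and to
  integrability\<close>

text \<open>If \<open>g\<close> exceeded \<open>C\<close> on a non-null part of \<open>A\<close>,
  integrating over that part would contradict the bound on sets. Finiteness of \<open>C\<close> and
  of the measure of \<open>A\<close> makes the strict comparison of integrals possible.\<close>

lemma AE_density_le:
  fixes g :: "'a \<Rightarrow> ennreal"
  assumes [measurable]: "g \<in> borel_measurable M" "A \<in> sets M"
    and fin: "emeasure M A < \<infinity>" "C < \<infinity>"
    and le: "\<And>E. E \<in> sets M \<Longrightarrow> E \<subseteq> A \<Longrightarrow> emeasure (density M g) E \<le> C * emeasure M E"
  shows "AE x in M. x \<in> A \<longrightarrow> g x \<le> C"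
proof (rule ccontr)
  assume neg: "\<not> ?thesis"
  define E where "E = {x\<in>space M. x \<in> A \<and> C < g x}"
  have [measurable]: "E \<in> sets M" unfolding E_def by measurable
  have EA: "E \<subseteq> A" by (auto simp: E_def)
  have "emeasure M E < \<infinity>" using emeasure_mono[OF EA, of M] fin by (auto intro: le_less_trans)
  then have f: "(\<integral>\<^sup>+ x. C * indicator E x \<partial>M) \<noteq> \<infinity>"
    using fin by (simp add: nn_integral_cmult ennreal_mult_eq_top_iff less_top)
  have "(\<integral>\<^sup>+ x. C * indicator E x \<partial>M) < (\<integral>\<^sup>+ x. g x * indicator E x \<partial>M)"
  proof (rule nn_integral_less)
    show "AE x in M. C * indicator E x \<le> g x * indicator E x"
      by (auto simp: E_def indicator_def)
    show "\<not> (AE x in M. g x * indicator E x \<le> C * indicator E x)"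
    proof
      assume "AE x in M. g x * indicator E x \<le> C * indicator E x"
      moreover have "AE x in M. x \<in> space M" by simp
      ultimately have "AE x in M. x \<in> A \<longrightarrow> g x \<le> C"
      proof eventually_elim
        case (elim x)
        then show ?case by (cases "x \<in> E") (auto simp: E_def not_less)
      qed
      then show False using neg by simp
    qed
  qed (use f in auto)
  also have "\<dots> = emeasure (density M g) E" by (simp add: emeasure_density)
  also have "\<dots> \<le> C * emeasure M E" using EA by (intro le) auto
  finally show False by (simp add: nn_integral_cmult)
qed

lemma AE_density_ge:
  fixes g :: "'a \<Rightarrow> ennreal"
  assumes [measurable]: "g \<in> borel_measurable M" "A \<in> sets M"
    and fin: "emeasure M A < \<infinity>" "C < \<infinity>"
    and ge: "\<And>E. E \<in> sets M \<Longrightarrow> E \<subseteq> A \<Longrightarrow> C * emeasure M E \<le> emeasure (density M g) E"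
  shows "AE x in M. x \<in> A \<longrightarrow> C \<le> g x"
proof (rule ccontr)
  assume neg: "\<not> ?thesis"
  define E where "E = {x\<in>space M. x \<in> A \<and> g x < C}"
  have [measurable]: "E \<in> sets M" unfolding E_def by measurable
  have EA: "E \<subseteq> A" by (auto simp: E_def)
  have "emeasure M E < \<infinity>" using emeasure_mono[OF EA, of M] fin by (auto intro: le_less_trans)
  then have f: "(\<integral>\<^sup>+ x. C * indicator E x \<partial>M) < \<infinity>"
    using fin by (simp add: nn_integral_cmult ennreal_mult_less_top)
  have le: "(\<integral>\<^sup>+ x. g x * indicator E x \<partial>M) \<le> (\<integral>\<^sup>+ x. C * indicator E x \<partial>M)"
    by (intro nn_integral_mono) (auto simp: E_def indicator_def)
  have "(\<integral>\<^sup>+ x. g x * indicator E x \<partial>M) < (\<integral>\<^sup>+ x. C * indicator E x \<partial>M)"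
  proof (rule nn_integral_less)
    show "AE x in M. g x * indicator E x \<le> C * indicator E x"
      by (auto simp: E_def indicator_def)
    show "\<not> (AE x in M. C * indicator E x \<le> g x * indicator E x)"
    proof
      assume "AE x in M. C * indicator E x \<le> g x * indicator E x"
      moreover have "AE x in M. x \<in> space M" by simp
      ultimately have "AE x in M. x \<in> A \<longrightarrow> C \<le> g x"
      proof eventually_elim
        case (elim x)
        then show ?case by (cases "x \<in> E") (auto simp: E_def not_less)
      qed
      then show False using neg by simp
    qed
  qed (use f le in auto)
  also have "\<dots> = C * emeasure M E" by (simp add: nn_integral_cmult)
  also have "\<dots> \<le> emeasure (density M g) E" using EA by (intro ge) auto
  also have "\<dots> = (\<integral>\<^sup>+ x. g x * indicator E x \<partial>M)" by (simp add: emeasure_density)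
  finally show False by simp
qed

text \<open>On shell k the function has order 2^(k \<alpha> d) and the volume order 2^(-k d), so the
  integral of its s-th power is comparable to a geometric series of ratio 2^(d (\<alpha> s - 1)),
  which converges iff \<alpha> s < 1.\<close>

lemma in_Lq_radial_singularity:
  fixes g :: "'a::euclidean_space \<Rightarrow> real" and r \<alpha> c1 c2 :: real
  assumes [measurable]: "g \<in> borel_measurable borel" and g0: "\<And>x. 0 \<le> g x"
    and r: "0 < r" and \<alpha>: "0 < \<alpha>" and c: "0 < c1" "0 < c2"
    and out: "AE y in lborel. y \<notin> cball 0 r \<longrightarrow> g y = 0"
    and low: "\<And>k. AE y in lborel. y \<in> annulus r k \<longrightarrow> c1 * 2 powr (real k * (\<alpha> * DIM('a))) \<le> g y"
    and upp: "\<And>k. AE y in lborel. y \<in> annulus r k \<longrightarrow> g y \<le> c2 * 2 powr (real k * (\<alpha> * DIM('a)))"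
    and q: "1 \<le> q"
  shows "in_Lq q g \<longleftrightarrow> q < ereal (1 / \<alpha>)"
proof (cases q)
  case PInf
  \<comment> \<open>The lower bounds tend to infinity with k and no shell is null.\<close>
  have "\<not> in_Lq \<infinity> g"
  proof
    assume "in_Lq \<infinity> g"
    then obtain C where C: "AE y in lborel. \<bar>g y\<bar> \<le> C" by (auto simp: in_Lq_def)
    let ?b = "2 powr (\<alpha> * DIM('a)) :: real"
    have "1 < ?b" using \<alpha> by (intro gr_one_powr) auto
    then obtain k where k: "C / c1 < ?b ^ k" using real_arch_pow by blast
    have b: "2 powr (real k * (\<alpha> * DIM('a))) = ?b ^ k"
      by (simp add: powr_realpow[symmetric] powr_powr mult.commute)
    have "AE y in lborel. y \<notin> (annulus r k :: 'a set)"
      using C low[of k]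
    proof eventually_elim
      case (elim y)
      have "C < c1 * 2 powr (real k * (\<alpha> * DIM('a)))" using k c b by (simp add: field_simps)
      then show ?case using elim by auto
    qed
    then have "emeasure lborel (annulus r k :: 'a set) = 0"
      by (subst (asm) AE_iff_measurable[of "annulus r k"]) auto
    moreover have "(1/2::real) ^ DIM('a) < 1" by (simp add: power_less_one_iff)
    then have "0 < unit_ball_vol DIM('a) * r ^ DIM('a) * (1 - (1/2) ^ DIM('a)) * ((1/2) ^ DIM('a)) ^ k"
      using r by (intro mult_pos_pos zero_less_power unit_ball_vol_pos) auto
    ultimately show False unfolding emeasure_annulus[OF r] ennreal_eq_0_iff by linarith
  qed
  then show ?thesis using PInf by simp
next
  case MInf
  then show ?thesis using q by simp
next
  case (real s)
  have s: "1 \<le> s" using q real by (simp add: one_ereal_def)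
  let ?d = "DIM('a)"
  define x where "x = 2 powr (\<alpha> * real ?d * s - real ?d)"
  define D where "D = unit_ball_vol ?d * r ^ ?d * (1 - (1/2) ^ ?d)"
  have x0: "0 < x" by (simp add: x_def)
  have "(1/2::real) ^ ?d < 1" by (simp add: power_less_one_iff)
  then have D0: "0 < D" using r by (simp add: D_def unit_ball_vol_pos)
  have x1: "x < 1 \<longleftrightarrow> s < 1 / \<alpha>"
  proof -
    have "x < 1 \<longleftrightarrow> \<alpha> * real ?d * s - real ?d < 0"
      unfolding x_def by (subst powr_less_cancel_iff[of 2 _ 0, symmetric]) auto
    also have "\<dots> \<longleftrightarrow> real ?d * (\<alpha> * s) < real ?d * 1" by (simp add: algebra_simps)
    also have "\<dots> \<longleftrightarrow> \<alpha> * s < 1" by (subst mult_less_cancel_left_pos) auto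
    also have "\<dots> \<longleftrightarrow> s < 1 / \<alpha>" using \<alpha> by (simp add: field_simps)
    finally show ?thesis .
  qed
  have pw: "(c * 2 powr (real k * (\<alpha> * ?d))) powr s * (D * ((1/2) ^ ?d) ^ k) = c powr s * D * x ^ k"
    if "0 < c" for c k
  proof -
    have "((1/2::real) ^ ?d) ^ k = 2 powr (- real ?d * real k)"
      by (simp add: power_mult[symmetric] powr_minus powr_realpow power_divide inverse_eq_divide flip: of_nat_mult)
    then show ?thesis using that
      by (simp add: powr_mult powr_powr x_def powr_realpow[symmetric] algebra_simps flip: powr_add)
  qed
  have L: "emeasure lborel (annulus r k :: 'a set) = ennreal (D * ((1/2) ^ ?d) ^ k)" for k
    using r by (simp add: emeasure_annulus D_def)
  define I where "I = (\<lambda>k. \<integral>\<^sup>+ y. ennreal (g y powr s) * indicator (annulus r k) y \<partial>lborel)"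
  have Ile: "I k \<le> ennreal (c2 powr s * D * x ^ k)" for k
  proof -
    have "I k \<le> (\<integral>\<^sup>+ y. ennreal ((c2 * 2 powr (real k * (\<alpha> * ?d))) powr s) * indicator (annulus r k :: 'a set) y \<partial>lborel)"
      unfolding I_def
    proof (rule nn_integral_mono_AE, use upp[of k] in eventually_elim)
      case (elim y)
      then show ?case using g0[of y] s by (auto simp: indicator_def intro!: ennreal_leI powr_mono2)
    qed
    also have "\<dots> = ennreal ((c2 * 2 powr (real k * (\<alpha> * ?d))) powr s) * emeasure lborel (annulus r k :: 'a set)"
      by (simp add: nn_integral_cmult)
    also have "\<dots> = ennreal (c2 powr s * D * x ^ k)"
      unfolding L pw[OF c(2), symmetric] using D0 by (simp add: ennreal_mult)
    finally show ?thesis .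
  qed
  have Ige: "ennreal (c1 powr s * D * x ^ k) \<le> I k" for k
  proof -
    have "ennreal (c1 powr s * D * x ^ k) = ennreal ((c1 * 2 powr (real k * (\<alpha> * ?d))) powr s) * emeasure lborel (annulus r k :: 'a set)"
      unfolding L pw[OF c(1), symmetric] using D0 by (simp add: ennreal_mult)
    also have "\<dots> = (\<integral>\<^sup>+ y. ennreal ((c1 * 2 powr (real k * (\<alpha> * ?d))) powr s) * indicator (annulus r k :: 'a set) y \<partial>lborel)"
      by (simp add: nn_integral_cmult)
    also have "\<dots> \<le> I k"
      unfolding I_def
    proof (rule nn_integral_mono_AE, use low[of k] in eventually_elim)
      case (elim y)
      then show ?case using g0[of y] s c by (auto simp: indicator_def intro!: ennreal_leI powr_mono2)
    qed
    finally show ?thesis .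
  qed
  have "(\<integral>\<^sup>+ y. ennreal (\<bar>g y\<bar> powr s) \<partial>lborel) = (\<integral>\<^sup>+ y. ennreal (g y powr s) * indicator (\<Union>k. annulus r k) y \<partial>lborel)"
  proof (rule nn_integral_cong_AE)
    \<comment> \<open>Inside the ball the shells miss only the origin, a null set.\<close>
    have "AE y in lborel. y \<noteq> (0::'a)" by (rule AE_lborel_singleton)
    then show "AE y in lborel. ennreal (\<bar>g y\<bar> powr s) = ennreal (g y powr s) * indicator (\<Union>k. annulus r k) y"
      using out by eventually_elim (use g0 s in \<open>auto simp: Union_annulus[OF r] indicator_def\<close>)
  qed
  also have "\<dots> = (\<Sum>k. I k)"
    unfolding I_def using disjoint_annulus[OF r] by (intro nn_integral_disjoint_family) auto
  finally have tot: "(\<integral>\<^sup>+ y. ennreal (\<bar>g y\<bar> powr s) \<partial>lborel) = (\<Sum>k. I k)" .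
  have "(\<Sum>k. I k) < \<infinity> \<longleftrightarrow> x < 1"
  proof
    assume x: "x < 1"
    have "(\<Sum>k. I k) \<le> (\<Sum>k. ennreal (c2 powr s * D * x ^ k))" by (intro suminf_le Ile) auto
    also have "\<dots> < \<infinity>"
    proof -
      have "summable (\<lambda>k. c2 powr s * D * x ^ k)" using x x0 by (intro summable_mult summable_geometric) auto
      then show ?thesis using D0 x0 by (subst suminf_ennreal2) auto
    qed
    finally show "(\<Sum>k. I k) < \<infinity>" .
  next
    assume fin: "(\<Sum>k. I k) < \<infinity>"
    show "x < 1"
    proof (rule ccontr)
      \<comment> \<open>With a ratio of at least 1 the terms stay above a fixed positive
        constant.\<close>
      assume "\<not> x < 1"
      then have "1 \<le> x ^ k" for k by (intro one_le_power) auto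
      then have "c1 powr s * D * 1 \<le> c1 powr s * D * x ^ k" for k
        using D0 by (intro mult_left_mono) auto
      then have "ennreal (c1 powr s * D) \<le> I k" for k
        using Ige[of k] by (metis ennreal_leI mult.right_neutral order_trans)
      then have "(\<Sum>k::nat. ennreal (c1 powr s * D)) \<le> (\<Sum>k. I k)" by (intro suminf_le) auto
      moreover have "(\<Sum>k::nat. ennreal (c1 powr s * D)) = \<infinity>"
        using D0 c by (simp add: ennreal_mult_top flip: nn_integral_count_space_nat)
      ultimately show False using fin by (simp add: top_unique)
    qed
  qed
  then show ?thesis using real x1 by (simp add: in_Lq_def tot)
qed

text \<open>As \<open>T\<close> inverts \<open>S\<close> on the ball, the new measure of a set E
  inside it is the normalized volume of its image under \<open>S\<close>. On each shell this volume
  is comparable to the volume of E times a power of the radius, by the Lipschitz bounds for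
  \<open>S\<close> and for its inverse. Radon-Nikodym then turns the bounds on sets into bounds on
  the density.\<close>

lemma pushforward_density:
  fixes S T :: "'a::euclidean_space \<Rightarrow> 'a" and r \<alpha> c1 c2 :: real
  assumes r: "0 < r" and \<alpha>: "0 < \<alpha>" and c: "0 < c1" "0 < c2"
    and S: "continuous_on (cball 0 r) S"
    and TS: "\<And>y. y \<in> cball 0 r \<Longrightarrow> T (S y) = y"
    and T [measurable]: "T \<in> borel_measurable borel"
    and lo: "\<And>\<rho> y z. 0 < \<rho> \<Longrightarrow> \<rho> \<le> r \<Longrightarrow> norm y \<in> {\<rho>/2..\<rho>} \<Longrightarrow> norm z \<in> {\<rho>/2..\<rho>} \<Longrightarrow>
        c1 * \<rho> powr (- \<alpha>) * norm (y - z) \<le> norm (S y - S z)"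
    and up: "\<And>\<rho> y z. 0 < \<rho> \<Longrightarrow> \<rho> \<le> r \<Longrightarrow> norm y \<in> {\<rho>/2..\<rho>} \<Longrightarrow> norm z \<in> {\<rho>/2..\<rho>} \<Longrightarrow>
        norm (S y - S z) \<le> c2 * \<rho> powr (- \<alpha>) * norm (y - z)"
  defines "K \<equiv> S ` cball 0 r"
  shows "0 < emeasure lborel K"
    and "\<exists>g. has_lebesgue_density (distr (uniform_measure lborel K) borel T) g \<and>
           (\<forall>q\<ge>1. in_Lq q g \<longleftrightarrow> q < ereal (1 / \<alpha>))"
proof -
  let ?d = "DIM('a)"
  have Kc: "compact K" unfolding K_def by (intro compact_continuous_image S) auto
  have [measurable]: "K \<in> sets borel" using Kc by (simp add: borel_compact)
  have Kfin: "emeasure lborel K < \<infinity>" using emeasure_compact_finite[OF Kc] .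
  \<comment> \<open>Written as a preimage under the Borel map \<open>T\<close>, the image of a Borel
    set is Borel.\<close>
  have SE: "S ` E = K \<inter> T -` E" if "E \<subseteq> cball 0 r" for E
    using that TS by (force simp: K_def)
  have SEm [measurable]: "S ` E \<in> sets borel" if "E \<subseteq> cball 0 r" "E \<in> sets borel" for E
  proof -
    have "T -` E \<in> sets borel" using measurable_sets[OF T that(2)] by simp
    then show ?thesis using SE[OF that(1)] by simp
  qed
  have ann: "annulus r k \<subseteq> (cball 0 r :: 'a set)" for k
    using Union_annulus[OF r, where 'a = 'a] by blast
  have annI: "norm y \<in> {r / 2 ^ k / 2..r / 2 ^ k}" if "y \<in> annulus r k" for y :: 'a and k
    using that by (auto simp: annulus_def field_simps)
  \<comment> \<open>Up to constants, the factor by which \<open>S\<close> enlarges volume on shell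
    k: 2^(k \<alpha>) for each of the d directions.\<close>
  define b where "b = (\<lambda>k. 2 powr (real k * (\<alpha> * ?d)))"
  have b0: "0 < b k" for k by (simp add: b_def)
  have rk: "0 < r / 2 ^ k" "r / 2 ^ k \<le> r" for k
    using r by (auto simp: field_simps)
  have pw: "(a * (r / 2 ^ k) powr (- \<alpha>)) ^ ?d = (a * r powr (- \<alpha>)) ^ ?d * b k" for a k
  proof -
    have "(r / 2 ^ k) powr (- \<alpha>) = r powr (- \<alpha>) * 2 powr (real k * \<alpha>)"
      using r by (simp add: powr_divide powr_minus field_simps powr_powr flip: powr_realpow)
    then have "(a * (r / 2 ^ k) powr (- \<alpha>)) ^ ?d = (a * r powr (- \<alpha>)) ^ ?d * (2 powr (real k * \<alpha>)) ^ ?d"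
      by (simp add: power_mult_distrib)
    then show ?thesis by (simp add: b_def powr_powr mult_ac flip: powr_realpow)
  qed
  define C1 where "C1 = (c1 * r powr (- \<alpha>)) ^ ?d"
  define C2 where "C2 = (c2 * r powr (- \<alpha>)) ^ ?d"
  have C: "0 < C1" "0 < C2" using c r by (auto simp: C1_def C2_def)
  have upE: "emeasure lborel (S ` E) \<le> ennreal (C2 * b k) * emeasure lborel E"
    if E: "E \<subseteq> annulus r k" "E \<in> sets borel" for E k
  proof -
    have "(c2 * (r / 2 ^ k) powr (- \<alpha>))-lipschitz_on E S"
      using c E(1) annI rk by (intro lipschitz_onI) (auto simp: dist_norm intro!: up)
    then show ?thesis
      unfolding C2_def pw[symmetric] using E ann[of k] by (intro lipschitz_emeasure_image_le SEm) auto
  qed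
  have loE: "ennreal (C1 * b k) * emeasure lborel E \<le> emeasure lborel (S ` E)"
    if E: "E \<subseteq> annulus r k" "E \<in> sets borel" for E k
  proof -
    let ?M = "c1 * (r / 2 ^ k) powr (- \<alpha>)"
    have M: "0 < ?M" using c r by simp
    \<comment> \<open>Expansion by \<open>S\<close> is a Lipschitz bound for its inverse, so the
      estimate for Lipschitz images yields the lower bound too.\<close>
    have "(1 / ?M)-lipschitz_on (S ` E) T"
    proof (rule lipschitz_onI)
      fix u v assume "u \<in> S ` E" "v \<in> S ` E"
      then obtain y z where yz: "y \<in> E" "z \<in> E" "u = S y" "v = S z" by auto
      then have "?M * norm (y - z) \<le> norm (S y - S z)" using E(1) annI rk by (intro lo) auto
      moreover have "T u = y" "T v = z" using yz E(1) ann[of k] TS by auto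
      ultimately show "dist (T u) (T v) \<le> 1 / ?M * dist u v"
        using M yz by (simp add: dist_norm field_simps)
    qed (use M in auto)
    moreover have TSE: "T ` S ` E = E" using E(1) ann[of k] TS by (force simp: image_image)
    ultimately have le: "emeasure lborel E \<le> ennreal ((1 / ?M) ^ ?d) * emeasure lborel (S ` E)"
      using lipschitz_emeasure_image_le[of "1 / ?M" "S ` E" T] E ann[of k] SEm[of E] by auto
    have "ennreal (?M ^ ?d) * emeasure lborel E \<le> ennreal (?M ^ ?d) * (ennreal ((1 / ?M) ^ ?d) * emeasure lborel (S ` E))"
      by (intro mult_left_mono le) auto
    also have "\<dots> = ennreal (?M ^ ?d * (1 / ?M) ^ ?d) * emeasure lborel (S ` E)"
      using M by (subst ennreal_mult) (auto simp: mult.assoc)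
    also have "?M ^ ?d * (1 / ?M) ^ ?d = 1" using c r by (simp flip: power_mult_distrib)
    finally show ?thesis unfolding pw C1_def by simp
  qed
  have A0: "0 < emeasure lborel (annulus r 0 :: 'a set)"
  proof -
    have "(1/2::real) ^ ?d < 1" by (simp add: power_less_one_iff)
    then show ?thesis unfolding emeasure_annulus[OF r]
      using r by (auto intro!: mult_pos_pos unit_ball_vol_pos)
  qed
  have "0 < ennreal (C1 * b 0) * emeasure lborel (annulus r 0 :: 'a set)"
    using A0 C b0[of 0] by (simp add: ennreal_zero_less_mult_iff)
  also have "\<dots> \<le> emeasure lborel (S ` annulus r 0)" by (rule loE) auto
  also have "\<dots> \<le> emeasure lborel K" using ann[of 0] by (intro emeasure_mono) (auto simp: K_def)
  finally show Kpos: "0 < emeasure lborel K" .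
  define m where "m = measure lborel K"
  have m: "emeasure lborel K = ennreal m" using Kfin by (simp add: m_def emeasure_eq_ennreal_measure)
  then have m0: "0 < m" using Kpos by simp
  let ?\<nu> = "distr (uniform_measure lborel K) borel T"
  have nu: "emeasure ?\<nu> E = emeasure lborel (K \<inter> T -` E) / ennreal m" if "E \<in> sets borel" for E
  proof -
    have "T -` E \<in> sets borel" using measurable_sets[OF T that] by simp
    then show ?thesis using that by (simp add: emeasure_distr m[symmetric])
  qed
  have nuS: "emeasure ?\<nu> E = emeasure lborel (S ` E) / ennreal m" if "E \<subseteq> cball 0 r" "E \<in> sets borel" for E
    using nu[OF that(2)] SE[OF that(1)] by simp
  have out: "emeasure ?\<nu> (- cball 0 r) = 0"
  proof -
    have "K \<inter> T -` (- cball 0 r) = {}" using TS by (auto simp: K_def)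
    then show ?thesis by (subst nu) auto
  qed
  \<comment> \<open>The Lipschitz constants of \<open>S\<close> are bounded on each shell but not up
    to the origin, so null sets are treated shell by shell; the origin is sent to a single
    point.\<close>
  have null: "emeasure ?\<nu> E = 0" if E: "emeasure lborel E = 0" "E \<in> sets borel" for E
  proof -
    have 0: "emeasure ?\<nu> (E \<inter> annulus r k) = 0" for k
    proof -
      have "emeasure lborel (E \<inter> annulus r k) \<le> emeasure lborel E" using E by (intro emeasure_mono) auto
      then have "emeasure lborel (E \<inter> annulus r k) = 0" using E by simp
      then have "emeasure lborel (S ` (E \<inter> annulus r k)) = 0"
        using upE[of "E \<inter> annulus r k" k] E by simp
      then show ?thesis using ann[of k] E by (subst nuS) auto
    qed
    have 1: "emeasure ?\<nu> {0} = 0" using r by (subst nuS) auto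
    have "E \<subseteq> (- cball 0 r) \<union> ({0} \<union> (\<Union>k. E \<inter> annulus r k))"
      using Union_annulus[OF r, where 'a = 'a] by auto
    moreover have "(- cball 0 r) \<union> ({0} \<union> (\<Union>k. E \<inter> annulus r k)) \<in> null_sets ?\<nu>"
      using 0 1 out E by (intro null_sets.Un null_sets_UN) (auto simp: null_sets_def)
    ultimately show ?thesis using E by (metis null_setsD1 null_sets_subset sets_distr)
  qed
  have "absolutely_continuous lborel ?\<nu>"
    unfolding absolutely_continuous_def using null by (auto simp: null_sets_def)
  then obtain h where h [measurable]: "h \<in> borel_measurable lborel" and hd: "density lborel h = ?\<nu>"
    using sigma_finite_measure.Radon_Nikodym[OF sigma_finite_lborel, of ?\<nu>] by auto
  have afin: "emeasure lborel (annulus r k :: 'a set) < \<infinity>" for k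
    by (simp add: emeasure_annulus[OF r])
  have hup: "AE y in lborel. y \<in> annulus r k \<longrightarrow> h y \<le> ennreal (C2 / m * b k)" for k
  proof (rule AE_density_le)
    fix E :: "'a set" assume E: "E \<in> sets lborel" "E \<subseteq> annulus r k"
    have "emeasure ?\<nu> E \<le> ennreal (C2 * b k) * emeasure lborel E / ennreal m"
      using E ann[of k] upE[of E k] by (subst nuS) (auto intro: divide_right_mono_ennreal)
    also have "\<dots> = ennreal (C2 / m * b k) * emeasure lborel E"
      using m0 C b0[of k] by (simp add: divide_ennreal_def inverse_ennreal ennreal_mult divide_inverse mult_ac)
    finally show "emeasure (density lborel h) E \<le> ennreal (C2 / m * b k) * emeasure lborel E"
      by (simp add: hd)
  qed (use afin in auto)
  have hlo: "AE y in lborel. y \<in> annulus r k \<longrightarrow> ennreal (C1 / m * b k) \<le> h y" for k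
  proof (rule AE_density_ge)
    fix E :: "'a set" assume E: "E \<in> sets lborel" "E \<subseteq> annulus r k"
    have "ennreal (C1 / m * b k) * emeasure lborel E = ennreal (C1 * b k) * emeasure lborel E / ennreal m"
      using m0 C b0[of k] by (simp add: divide_ennreal_def inverse_ennreal ennreal_mult divide_inverse mult_ac)
    also have "\<dots> \<le> emeasure ?\<nu> E"
      using E ann[of k] loE[of E k] by (subst nuS) (auto intro: divide_right_mono_ennreal)
    finally show "ennreal (C1 / m * b k) * emeasure lborel E \<le> emeasure (density lborel h) E"
      by (simp add: hd)
  qed (use afin in auto)
  have hout: "AE y in lborel. y \<notin> cball 0 r \<longrightarrow> h y = 0"
  proof -
    have "(\<integral>\<^sup>+ y. h y * indicator (- cball 0 r) y \<partial>lborel) = 0"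
      using out by (simp add: hd[symmetric] emeasure_density)
    then show ?thesis by (subst (asm) nn_integral_0_iff_AE) (auto simp: indicator_def)
  qed
  define g where "g = (\<lambda>y. enn2real (h y))"
  have [measurable]: "g \<in> borel_measurable borel" unfolding g_def using h by simp
  \<comment> \<open>The Radon-Nikodym density is \<open>ennreal\<close>-valued; the upper bounds on
    the shells make it finite almost everywhere, so it has a real representative.\<close>
  have hg: "AE y in lborel. h y = ennreal (g y)"
  proof -
    have "AE y in lborel. \<forall>k. y \<in> annulus r k \<longrightarrow> h y \<le> ennreal (C2 / m * b k)"
      using hup by (simp add: AE_all_countable)
    moreover have "AE y in lborel. y \<noteq> (0::'a)" by (rule AE_lborel_singleton)
    ultimately show ?thesis using hout
    proof eventually_elim
      case (elim y)
      have "h y < \<infinity>"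
      proof (cases "y \<in> cball 0 r")
        case True
        then have "y \<in> (\<Union>k. annulus r k)" using elim by (subst Union_annulus[OF r]) auto
        then show ?thesis using elim(1) by (auto intro: le_less_trans)
      qed (use elim in auto)
      then show ?case by (simp add: g_def)
    qed
  qed
  have "has_lebesgue_density ?\<nu> g"
    unfolding has_lebesgue_density_def using hg h
    by (auto simp: g_def hd[symmetric] intro!: density_cong)
  moreover have "in_Lq q g \<longleftrightarrow> q < ereal (1 / \<alpha>)" if "1 \<le> q" for q
  proof (rule in_Lq_radial_singularity[OF _ _ r \<alpha>, of g "C1 / m" "C2 / m"])
    show "AE y in lborel. y \<notin> cball 0 r \<longrightarrow> g y = 0"
      using hout by eventually_elim (simp add: g_def)
    show "AE y in lborel. y \<in> annulus r k \<longrightarrow> C1 / m * 2 powr (real k * (\<alpha> * ?d)) \<le> g y" for k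
      using hlo[of k] hg
    proof eventually_elim
      case (elim y)
      have "0 \<le> g y" by (simp add: g_def)
      then show ?case using elim by (auto simp: b_def)
    qed
    show "AE y in lborel. y \<in> annulus r k \<longrightarrow> g y \<le> C2 / m * 2 powr (real k * (\<alpha> * ?d))" for k
      using hup[of k] hg
    proof eventually_elim
      case (elim y)
      have "0 \<le> C2 / m * b k" using C m0 b0[of k] by simp
      then show ?case using elim by (auto simp: b_def)
    qed
  qed (use C m0 that in \<open>auto simp: g_def\<close>)
  ultimately show "\<exists>g. has_lebesgue_density ?\<nu> g \<and> (\<forall>q\<ge>1. in_Lq q g \<longleftrightarrow> q < ereal (1 / \<alpha>))"
    by blast
qed

section \<open>Couplings and Wasserstein distance\<close>

text \<open>A point outside \<open>K\<close> has a ball of measure 0 around it, so the support lies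
  in \<open>K\<close>. It is closed because every point of a null ball is the centre of a smaller
  null ball.\<close>

lemma compact_msupport:
  assumes "compact K" "emeasure \<mu> (- K) = 0" "sets \<mu> = sets borel"
  shows "compact (msupport \<mu>)"
proof -
  have sub: "msupport \<mu> \<subseteq> K"
  proof
    fix x assume x: "x \<in> msupport \<mu>"
    show "x \<in> K"
    proof (rule ccontr)
      assume "x \<notin> K"
      then obtain e where e: "e > 0" "ball x e \<subseteq> - K"
        using compact_imp_closed[OF assms(1)] by (meson ComplI openE open_Compl)
      have "emeasure \<mu> (ball x e) \<le> emeasure \<mu> (- K)"
        using e assms compact_imp_closed[OF assms(1)] by (intro emeasure_mono) auto
      then show False using x e assms by (auto simp: msupport_def)
    qed
  qed
  have "open (- msupport \<mu>)"
  proof (subst open_subopen, rule ballI)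
    fix x assume "x \<in> - msupport \<mu>"
    then obtain e where e: "e > 0" "emeasure \<mu> (ball x e) = 0" by (auto simp: msupport_def zero_less_iff_neq_zero)
    have "ball x e \<subseteq> - msupport \<mu>"
    proof
      fix y assume "y \<in> ball x e"
      then obtain d where d: "d > 0" "ball y d \<subseteq> ball x e" by (meson openE open_ball)
      then have "emeasure \<mu> (ball y d) \<le> emeasure \<mu> (ball x e)"
        using assms by (intro emeasure_mono) auto
      then show "y \<in> - msupport \<mu>" using d e by (auto simp: msupport_def)
    qed
    then show "\<exists>T. open T \<and> x \<in> T \<and> T \<subseteq> - msupport \<mu>" using e by (intro exI[of _ "ball x e"]) auto
  qed
  then have "compact (K \<inter> msupport \<mu>)" using assms(1) by (intro compact_Int_closed) (simp_all add: closed_def)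
  then show ?thesis using sub by (simp add: Int_absorb1)
qed

section \<open>Integrability of the cost, couplings and near-optimality\<close>

lemma norm_diff_powr_le:
  fixes x y :: "'a::real_normed_vector"
  assumes "0 \<le> p"
  shows "norm (x - y) powr p \<le> 2 powr p * (norm x powr p + norm y powr p)"
proof -
  have "norm (x - y) \<le> 2 * max (norm x) (norm y)" using norm_triangle_ineq4[of x y] by linarith
  then have "norm (x - y) powr p \<le> (2 * max (norm x) (norm y)) powr p" using assms by (intro powr_mono2) auto
  also have "\<dots> = 2 powr p * max (norm x) (norm y) powr p" by (subst powr_mult) auto
  also have "\<dots> \<le> 2 powr p * (norm x powr p + norm y powr p)" by (intro mult_left_mono) (auto simp: max_def)
  finally show ?thesis .
qed

lemma Pp_prob_space: "\<nu> \<in> Pp p \<Longrightarrow> prob_space \<nu>"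
  and Pp_sets: "\<nu> \<in> Pp p \<Longrightarrow> sets \<nu> = sets borel"
  by (auto simp: Pp_def borel_prob_def)

lemma Pp_integrable:
  fixes \<nu> :: "'a::euclidean_space measure"
  assumes "\<nu> \<in> Pp p" "0 \<le> p"
  shows "integrable \<nu> (\<lambda>x. norm (x - z) powr p)"
proof -
  interpret prob_space \<nu> using Pp_prob_space[OF assms(1)] .
  have [measurable_cong]: "sets \<nu> = sets borel" using Pp_sets[OF assms(1)] .
  have 0: "integrable \<nu> (\<lambda>x. norm x powr p)"
    using assms by (intro integrableI_nonneg) (auto simp: Pp_def)
  show ?thesis
  proof (rule Bochner_Integration.integrable_bound)
    show "integrable \<nu> (\<lambda>x. 2 powr p * (norm x powr p + norm z powr p))" using 0 by simp
    show "AE x in \<nu>. norm (norm (x - z) powr p) \<le> norm (2 powr p * (norm x powr p + norm z powr p))"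
    proof (rule AE_I2)
      fix x :: 'a
      have "0 \<le> 2 powr p * (norm x powr p + norm z powr p)" by simp
      then show "norm (norm (x - z) powr p) \<le> norm (2 powr p * (norm x powr p + norm z powr p))"
        using norm_diff_powr_le[OF assms(2), of x z] by simp
    qed
  qed measurable
qed

lemma couplingsD:
  fixes \<mu> \<nu> :: "'a::euclidean_space measure"
  assumes "\<eta> \<in> couplings \<mu> \<nu>"
  shows "prob_space \<eta>" "sets \<eta> = sets (borel \<Otimes>\<^sub>M borel)" "\<mu> = distr \<eta> borel fst" "\<nu> = distr \<eta> borel snd"
  using assms unfolding couplings_def borel_prob_def borel_prod[symmetric] by simp_all

lemma couplings_integrable:
  fixes \<mu> \<nu> :: "'a::euclidean_space measure"
  assumes "\<eta> \<in> couplings \<mu> \<nu>" "\<mu> \<in> Pp p" "\<nu> \<in> Pp p" "0 \<le> p"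
  shows "integrable \<eta> (\<lambda>z. norm (fst z - a) powr p)"
    and "integrable \<eta> (\<lambda>z. norm (snd z - a) powr p)"
    and "integrable \<eta> (\<lambda>z. norm (fst z - snd z) powr p)"
proof -
  note c = couplingsD[OF assms(1)]
  have [measurable_cong]: "sets \<eta> = sets (borel \<Otimes>\<^sub>M borel)" using c by simp
  show 1: "integrable \<eta> (\<lambda>z. norm (fst z - a) powr p)" for a
  proof (rule integrable_distr[where T = fst and M' = borel and f = "\<lambda>x. norm (x - a) powr p"])
    show "integrable (distr \<eta> borel fst) (\<lambda>x. norm (x - a) powr p)"
      using Pp_integrable[OF assms(2,4), of a] c(3) by simp
  qed measurable
  show 2: "integrable \<eta> (\<lambda>z. norm (snd z - a) powr p)" for a
  proof (rule integrable_distr[where T = snd and M' = borel and f = "\<lambda>x. norm (x - a) powr p"])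
    show "integrable (distr \<eta> borel snd) (\<lambda>x. norm (x - a) powr p)"
      using Pp_integrable[OF assms(3,4), of a] c(4) by simp
  qed measurable
  show "integrable \<eta> (\<lambda>z. norm (fst z - snd z) powr p)"
  proof (rule Bochner_Integration.integrable_bound)
    show "integrable \<eta> (\<lambda>z. 2 powr p * (norm (fst z - 0) powr p + norm (snd z - 0) powr p))"
      using 1[of 0] 2[of 0] by (intro integrable_mult_right Bochner_Integration.integrable_add)
    show "AE z in \<eta>. norm (norm (fst z - snd z) powr p) \<le> norm (2 powr p * (norm (fst z - 0) powr p + norm (snd z - 0) powr p))"
    proof (rule AE_I2)
      fix z :: "'a \<times> 'a"
      have "0 \<le> 2 powr p * (norm (fst z) powr p + norm (snd z) powr p)" by simp
      then show "norm (norm (fst z - snd z) powr p) \<le> norm (2 powr p * (norm (fst z - 0) powr p + norm (snd z - 0) powr p))"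
        using norm_diff_powr_le[OF assms(4), of "fst z" "snd z"] by simp
    qed
  qed measurable
qed

lemma couplings_nonempty:
  fixes \<mu> \<nu> :: "'a::euclidean_space measure"
  assumes "borel_prob \<mu>" "borel_prob \<nu>"
  shows "\<mu> \<Otimes>\<^sub>M \<nu> \<in> couplings \<mu> \<nu>"
proof -
  interpret M: prob_space \<mu> using assms by (simp add: borel_prob_def)
  interpret N: prob_space \<nu> using assms by (simp add: borel_prob_def)
  interpret P: pair_prob_space \<mu> \<nu> ..
  have s: "sets \<mu> = sets borel" "sets \<nu> = sets borel" using assms by (auto simp: borel_prob_def)
  have sp: "space \<mu> = UNIV" "space \<nu> = UNIV" using s[THEN sets_eq_imp_space_eq] by auto
  have fst: "fst \<in> measurable (\<mu> \<Otimes>\<^sub>M \<nu>) borel"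
    by (subst measurable_cong_sets[OF refl s(1)[symmetric]]) (rule measurable_fst)
  have snd: "snd \<in> measurable (\<mu> \<Otimes>\<^sub>M \<nu>) borel"
    by (subst measurable_cong_sets[OF refl s(2)[symmetric]]) (rule measurable_snd)
  have 1: "distr (\<mu> \<Otimes>\<^sub>M \<nu>) borel fst = \<mu>"
  proof (rule measure_eqI)
    fix A assume "A \<in> sets (distr (\<mu> \<Otimes>\<^sub>M \<nu>) borel fst)"
    then have A: "A \<in> sets \<mu>" using s by simp
    have "emeasure (distr (\<mu> \<Otimes>\<^sub>M \<nu>) borel fst) A = emeasure (\<mu> \<Otimes>\<^sub>M \<nu>) (A \<times> space \<nu>)"
      using A s sp fst by (subst emeasure_distr) (auto simp: space_pair_measure intro!: arg_cong[where f = "emeasure (\<mu> \<Otimes>\<^sub>M \<nu>)"])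
    then show "emeasure (distr (\<mu> \<Otimes>\<^sub>M \<nu>) borel fst) A = emeasure \<mu> A"
      using A by (simp add: N.emeasure_pair_measure_Times N.emeasure_space_1)
  qed (use s in simp)
  have 2: "distr (\<mu> \<Otimes>\<^sub>M \<nu>) borel snd = \<nu>"
  proof (rule measure_eqI)
    fix A assume "A \<in> sets (distr (\<mu> \<Otimes>\<^sub>M \<nu>) borel snd)"
    then have A: "A \<in> sets \<nu>" using s by simp
    have "emeasure (distr (\<mu> \<Otimes>\<^sub>M \<nu>) borel snd) A = emeasure (\<mu> \<Otimes>\<^sub>M \<nu>) (space \<mu> \<times> A)"
      using A s sp snd by (subst emeasure_distr) (auto simp: space_pair_measure intro!: arg_cong[where f = "emeasure (\<mu> \<Otimes>\<^sub>M \<nu>)"])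
    then show "emeasure (distr (\<mu> \<Otimes>\<^sub>M \<nu>) borel snd) A = emeasure \<nu> A"
      using A by (simp add: N.emeasure_pair_measure_Times M.emeasure_space_1)
  qed (use s in simp)
  have "sets (\<mu> \<Otimes>\<^sub>M \<nu>) = sets (borel :: ('a \<times> 'a) measure)"
    unfolding borel_prod[symmetric] by (rule sets_pair_measure_cong[OF s])
  then show ?thesis using 1 2 P.prob_space_axioms by (simp add: couplings_def borel_prob_def)
qed

lemma wasserstein_le:
  assumes "\<eta> \<in> couplings \<mu> \<nu>" "0 < p"
  shows "wasserstein p \<mu> \<nu> powr p \<le> (\<integral>z. norm (fst z - snd z) powr p \<partial>\<eta>)"
proof -
  let ?J = "\<lambda>\<eta>. (\<integral>z. norm (fst z - snd z) powr p \<partial>\<eta>)"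
  have J0: "0 \<le> ?J \<eta>" for \<eta> by (intro Bochner_Integration.integral_nonneg) auto
  have bdd: "bdd_below ((\<lambda>\<eta>. ?J \<eta> powr (1 / p)) ` couplings \<mu> \<nu>)" by (intro bdd_belowI[of _ 0]) auto
  have "0 \<le> wasserstein p \<mu> \<nu>" unfolding wasserstein_def using assms by (intro cINF_greatest) auto
  moreover have "wasserstein p \<mu> \<nu> \<le> ?J \<eta> powr (1 / p)"
    unfolding wasserstein_def by (rule cINF_lower[OF bdd assms(1)])
  ultimately have "wasserstein p \<mu> \<nu> powr p \<le> (?J \<eta> powr (1 / p)) powr p"
    using assms by (intro powr_mono2) auto
  then show ?thesis using assms J0[of \<eta>] by (simp add: powr_powr)
qed

text \<open>If every coupling cost at least W^p + e, then p-th roots and the infimum would give W^p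
  + e \<le> W^p.\<close>

lemma wasserstein_approx:
  assumes "couplings \<mu> \<nu> \<noteq> {}" "0 < p" "0 < e"
  shows "\<exists>\<eta>\<in>couplings \<mu> \<nu>. (\<integral>z. norm (fst z - snd z) powr p \<partial>\<eta>) < wasserstein p \<mu> \<nu> powr p + e"
proof (rule ccontr)
  let ?J = "\<lambda>\<eta>. (\<integral>z. norm (fst z - snd z) powr p \<partial>\<eta>)"
  let ?c = "wasserstein p \<mu> \<nu> powr p + e"
  assume "\<not> ?thesis"
  then have "?c \<le> ?J \<eta>" if "\<eta> \<in> couplings \<mu> \<nu>" for \<eta> using that by (force simp: not_less)
  moreover have c0: "0 < ?c" using assms by (intro add_nonneg_pos) auto
  ultimately have "?c powr (1 / p) \<le> ?J \<eta> powr (1 / p)" if "\<eta> \<in> couplings \<mu> \<nu>" for \<eta>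
    using that assms by (intro powr_mono2) auto
  then have "?c powr (1 / p) \<le> wasserstein p \<mu> \<nu>"
    unfolding wasserstein_def using assms by (intro cINF_greatest) auto
  then have "(?c powr (1 / p)) powr p \<le> wasserstein p \<mu> \<nu> powr p" using assms by (intro powr_mono2) auto
  then show False using assms c0 by (simp add: powr_powr)
qed

text \<open>Under a coupling with a Dirac mass the first coordinate equals \<open>x\<close> almost
  surely, so the cost depends on the second marginal alone and the infimum is over a
  constant.\<close>

lemma wasserstein_return:
  fixes \<nu> :: "'a::euclidean_space measure"
  assumes "borel_prob \<nu>" "0 < p"
  shows "wasserstein p (return borel x) \<nu> powr p = (\<integral>y. norm (y - x) powr p \<partial>\<nu>)"
proof -
  have bp: "borel_prob (return borel x)" by (simp add: borel_prob_def prob_space_return)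
  have ne: "couplings (return borel x) \<nu> \<noteq> {}" using couplings_nonempty[OF bp assms(1)] by auto
  have J: "(\<integral>z. norm (fst z - snd z) powr p \<partial>\<eta>) = (\<integral>y. norm (y - x) powr p \<partial>\<nu>)"
    if \<eta>: "\<eta> \<in> couplings (return borel x) \<nu>" for \<eta>
  proof -
    note c = couplingsD[OF \<eta>]
    have [measurable_cong]: "sets \<eta> = sets (borel \<Otimes>\<^sub>M borel)" using c by simp
    have "AE y in return borel x. y = x" by (subst AE_return) auto
    then have ae: "AE z in \<eta>. fst z = x" unfolding c(3) by (subst (asm) AE_distr_iff) auto
    have "(\<integral>z. norm (fst z - snd z) powr p \<partial>\<eta>) = (\<integral>z. norm (snd z - x) powr p \<partial>\<eta>)"
      using ae by (intro integral_cong_AE) (auto simp: norm_minus_commute)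
    also have "\<dots> = (\<integral>y. norm (y - x) powr p \<partial>distr \<eta> borel snd)"
      by (subst integral_distr) auto
    finally show ?thesis using c(4) by simp
  qed
  have "0 \<le> (\<integral>y. norm (y - x) powr p \<partial>\<nu>)" by (intro Bochner_Integration.integral_nonneg) auto
  moreover have "wasserstein p (return borel x) \<nu> = (\<integral>y. norm (y - x) powr p \<partial>\<nu>) powr (1 / p)"
    unfolding wasserstein_def using cINF_const[OF ne] by (simp add: J cong: INF_cong)
  ultimately show ?thesis using assms by (simp add: powr_powr)
qed

section \<open>Measures joined by couplings concentrated near the diagonal\<close>

text \<open>If the second coordinate lies in \<open>A\<close> and the two are \<epsilon>-close, the
  first lies in the closed \<epsilon>-neighbourhood of \<open>A\<close>. These neighbourhoods
  decrease to the closed set \<open>A\<close> as \<epsilon> tends to 0.\<close>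

lemma couplings_closed_le:
  fixes \<mu> \<nu> :: "'a::euclidean_space measure"
  assumes close: "\<And>\<epsilon> e. 0 < \<epsilon> \<Longrightarrow> 0 < e \<Longrightarrow> \<exists>\<eta>\<in>couplings \<mu> \<nu>. measure \<eta> {z. \<epsilon> \<le> dist (fst z) (snd z)} \<le> e"
    and A: "closed A"
  shows "measure \<nu> A \<le> measure \<mu> A"
\<comment> \<open>\<open>infdist\<close> to the empty set is 0 by convention, so the neighbourhoods
  would not shrink to \<open>A\<close> in that case.\<close>
proof (cases "A = {}")
  case False
  obtain \<eta>0 where "\<eta>0 \<in> couplings \<mu> \<nu>" using close[of 1 1] by auto
  then have mu: "prob_space \<mu>" "sets \<mu> = sets borel"
    using couplingsD[of \<eta>0 \<mu> \<nu>] prob_space.prob_space_distr[of \<eta>0 fst borel]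
    by (auto simp: measurable_cong_sets[OF couplingsD(2) refl])
  interpret prob_space \<mu> by (rule mu)
  define B where "B = (\<lambda>n::nat. {y. infdist y A \<le> 1 / real (Suc n)})"
  have B: "closed (B n)" for n
    unfolding B_def by (intro closed_Collect_le continuous_intros)
  have step: "measure \<nu> A \<le> measure \<mu> (B n)" for n
  proof (rule field_le_epsilon)
    fix e :: real assume e: "0 < e"
    let ?\<epsilon> = "1 / real (Suc n)"
    obtain \<eta> where \<eta>: "\<eta> \<in> couplings \<mu> \<nu>" "measure \<eta> {z. ?\<epsilon> \<le> dist (fst z) (snd z)} \<le> e"
      using close[of ?\<epsilon> e] e by auto
    note c = couplingsD[OF \<eta>(1)]
    interpret E: prob_space \<eta> by (rule c)
    have [measurable_cong]: "sets \<eta> = sets (borel \<Otimes>\<^sub>M borel)" using c by simp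
    have sp: "space \<eta> = UNIV" using c(2)[THEN sets_eq_imp_space_eq] by (simp add: space_pair_measure)
    have [measurable]: "A \<in> sets borel" "B n \<in> sets borel" using A B by auto
    have m1: "snd -` A \<in> sets \<eta>" "fst -` B n \<in> sets \<eta>" "{z. ?\<epsilon> \<le> dist (fst z) (snd z)} \<in> sets \<eta>"
      using measurable_sets[of snd \<eta> borel A] measurable_sets[of fst \<eta> borel "B n"]
        measurable_sets[of "\<lambda>z. dist (fst z) (snd z)" \<eta> borel "{?\<epsilon>..}"] sp by (auto simp: vimage_def)
    have "measure \<nu> A = measure \<eta> (snd -` A)" unfolding c(4) by (subst measure_distr) (auto simp: sp)
    also have "\<dots> \<le> measure \<eta> (fst -` B n \<union> {z. ?\<epsilon> \<le> dist (fst z) (snd z)})"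
    proof (rule E.finite_measure_mono)
      show "snd -` A \<subseteq> fst -` B n \<union> {z. ?\<epsilon> \<le> dist (fst z) (snd z)}"
      proof
        fix z :: "'a \<times> 'a" assume "z \<in> snd -` A"
        then have "infdist (fst z) A \<le> dist (fst z) (snd z)" by (intro infdist_le) auto
        then show "z \<in> fst -` B n \<union> {z. ?\<epsilon> \<le> dist (fst z) (snd z)}" by (auto simp: B_def)
      qed
    qed (use m1 in auto)
    also have "\<dots> \<le> measure \<eta> (fst -` B n) + measure \<eta> {z. ?\<epsilon> \<le> dist (fst z) (snd z)}"
      using m1 by (intro measure_Un_le) auto
    also have "measure \<eta> (fst -` B n) = measure \<mu> (B n)" unfolding c(3) by (subst measure_distr) (auto simp: sp)
    finally show "measure \<nu> A \<le> measure \<mu> (B n) + e" using \<eta>(2) by linarith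
  qed
  have "(\<lambda>n. measure \<mu> (B n)) \<longlonglongrightarrow> measure \<mu> (\<Inter>n. B n)"
  proof (rule finite_Lim_measure_decseq)
    show "range B \<subseteq> sets \<mu>" using B mu by auto
    show "decseq B" unfolding B_def
    proof (intro decseq_SucI subsetI CollectI)
      fix n and y assume "y \<in> {y. infdist y A \<le> 1 / real (Suc (Suc n))}"
      moreover have "1 / real (Suc (Suc n)) \<le> 1 / real (Suc n)" by (intro divide_left_mono) auto
      ultimately show "infdist y A \<le> 1 / real (Suc n)" by auto
    qed
  qed
  moreover have "(\<Inter>n. B n) = A"
  proof (intro equalityI subsetI)
    fix y assume y: "y \<in> (\<Inter>n. B n)"
    have "infdist y A \<le> 0"
    proof (rule field_le_epsilon)
      fix e :: real assume "0 < e"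
      then obtain n where "1 / real (Suc n) < e" using nat_approx_posE by blast
      moreover have "infdist y A \<le> 1 / real (Suc n)" using y by (auto simp: B_def)
      ultimately show "infdist y A \<le> 0 + e" by linarith
    qed
    then have "infdist y A = 0" using infdist_nonneg[of y A] by linarith
    then show "y \<in> A" using in_closed_iff_infdist_zero[OF A False] by simp
  next
    fix y assume "y \<in> A"
    then show "y \<in> (\<Inter>n. B n)" by (simp add: B_def)
  qed
  ultimately show ?thesis using step by (metis LIMSEQ_le_const)
qed simp

lemma couplings_swap:
  fixes \<mu> \<nu> :: "'a::euclidean_space measure"
  assumes "\<eta> \<in> couplings \<mu> \<nu>"
  shows "distr \<eta> borel (\<lambda>z. (snd z, fst z)) \<in> couplings \<nu> \<mu>"
proof -
  note c = couplingsD[OF assms]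
  have [measurable_cong]: "sets \<eta> = sets (borel \<Otimes>\<^sub>M borel)" using c by simp
  have m [measurable]: "(\<lambda>z. (snd z, fst z)) \<in> \<eta> \<rightarrow>\<^sub>M borel"
    unfolding borel_prod[symmetric] by measurable
  have "prob_space (distr \<eta> borel (\<lambda>z. (snd z, fst z)))" by (rule prob_space.prob_space_distr[OF c(1) m])
  moreover have "(fst :: 'a \<times> 'a \<Rightarrow> 'a) \<in> borel \<rightarrow>\<^sub>M borel" "(snd :: 'a \<times> 'a \<Rightarrow> 'a) \<in> borel \<rightarrow>\<^sub>M borel"
    unfolding borel_prod[symmetric] by measurable
  ultimately show ?thesis using c(3,4) m
    by (simp add: couplings_def borel_prob_def distr_distr comp_def)
qed

text \<open>Swapping the coordinates gives both inequalities on closed sets, a generator of the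
  Borel sets that is stable under intersection.\<close>

lemma couplings_close_imp_eq:
  fixes \<mu> \<nu> :: "'a::euclidean_space measure"
  assumes mu: "borel_prob \<mu>" and nu: "borel_prob \<nu>"
    and close: "\<And>\<epsilon> e. 0 < \<epsilon> \<Longrightarrow> 0 < e \<Longrightarrow> \<exists>\<eta>\<in>couplings \<mu> \<nu>. measure \<eta> {z. \<epsilon> \<le> dist (fst z) (snd z)} \<le> e"
  shows "\<mu> = \<nu>"
proof -
  interpret M: prob_space \<mu> using mu by (simp add: borel_prob_def)
  interpret N: prob_space \<nu> using nu by (simp add: borel_prob_def)
  have close': "\<exists>\<eta>\<in>couplings \<nu> \<mu>. measure \<eta> {z. \<epsilon> \<le> dist (fst z) (snd z)} \<le> e"
    if e: "0 < \<epsilon>" "0 < e" for \<epsilon> e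
  proof -
    obtain \<eta> where \<eta>: "\<eta> \<in> couplings \<mu> \<nu>" "measure \<eta> {z. \<epsilon> \<le> dist (fst z) (snd z)} \<le> e"
      using close[OF e] by auto
    note c = couplingsD[OF \<eta>(1)]
    have [measurable_cong]: "sets \<eta> = sets (borel \<Otimes>\<^sub>M borel)" using c by simp
    have sp: "space \<eta> = UNIV" using c(2)[THEN sets_eq_imp_space_eq] by (simp add: space_pair_measure)
    have m [measurable]: "(\<lambda>z. (snd z, fst z)) \<in> \<eta> \<rightarrow>\<^sub>M borel"
      unfolding borel_prod[symmetric] by measurable
    have "closed {z::'a\<times>'a. \<epsilon> \<le> dist (fst z) (snd z)}" by (intro closed_Collect_le continuous_intros)
    then have "measure (distr \<eta> borel (\<lambda>z. (snd z, fst z))) {z. \<epsilon> \<le> dist (fst z) (snd z)}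
       = measure \<eta> {z. \<epsilon> \<le> dist (fst z) (snd z)}"
      by (subst measure_distr[OF m]) (auto simp: sp dist_commute)
    then have "measure (distr \<eta> borel (\<lambda>z. (snd z, fst z))) {z. \<epsilon> \<le> dist (fst z) (snd z)} \<le> e"
      using \<eta>(2) by simp
    then show ?thesis by (rule bexI[OF _ couplings_swap[OF \<eta>(1)]])
  qed
  have eq: "measure \<mu> A = measure \<nu> A" if "closed A" for A
    using couplings_closed_le[OF close that] couplings_closed_le[OF close' that] by simp
  show ?thesis
  proof (rule measure_eqI_generator_eq[where E = "Collect closed" and \<Omega> = UNIV and A = "\<lambda>_. UNIV"])
    show "Int_stable (Collect closed :: 'a set set)" by (auto simp: Int_stable_def)
    show "emeasure \<mu> X = emeasure \<nu> X" if "X \<in> Collect closed" for X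
      using eq[of X] that by (simp add: M.emeasure_eq_measure N.emeasure_eq_measure)
    show "sets \<mu> = sigma_sets UNIV (Collect closed)" "sets \<nu> = sigma_sets UNIV (Collect closed)"
      using mu nu by (simp_all add: borel_prob_def borel_eq_closed)
  qed auto
qed

section \<open>Barycenters of one measure and Dirac masses\<close>

text \<open>
  The existence of optimal couplings is not needed for uniqueness: for a competing
  minimizer, near-optimal couplings concentrate on the graph of \<open>T\<close> because the cost gap is
  uniformly positive away from it.
\<close>

lemma barycenter_pushforward:
  fixes \<mu> :: "'a::euclidean_space measure" and T :: "'a \<Rightarrow> 'a" and p l a b r :: real and z2 z3 :: 'a
  assumes p: "1 < p" and pos: "0 < l" "0 < a" "0 < b"
    and mu: "\<mu> \<in> Pp p" and K: "AE x in \<mu>. x \<in> K"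
    and T: "T \<in> borel_measurable borel" and Tr: "\<And>x. T x \<in> cball 0 r"
  defines "cost \<equiv> \<lambda>x z. l * norm (x - z) powr p + a * norm (z - z2) powr p + b * norm (z - z3) powr p"
  defines "F \<equiv> \<lambda>\<nu>. l * wasserstein p \<mu> \<nu> powr p + a * (\<integral>z. norm (z - z2) powr p \<partial>\<nu>) + b * (\<integral>z. norm (z - z3) powr p \<partial>\<nu>)"
  defines "\<nu> \<equiv> distr \<mu> borel T"
  assumes gap: "\<And>x z. x \<in> K \<Longrightarrow> cost x (T x) + a * breg p (T x - z2) (z - z2) \<le> cost x z"
  shows "\<nu> \<in> Pp p" and "\<And>\<nu>'. \<nu>' \<in> Pp p \<Longrightarrow> F \<nu> \<le> F \<nu>'"
    and "\<And>\<nu>'. \<nu>' \<in> Pp p \<Longrightarrow> F \<nu>' \<le> F \<nu> \<Longrightarrow> \<nu>' = \<nu>"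
proof -
  have p0: "0 < p" "0 \<le> p" using p by auto
  interpret M: prob_space \<mu> using Pp_prob_space[OF mu] .
  have s\<mu> [measurable_cong]: "sets \<mu> = sets borel" using Pp_sets[OF mu] .
  note [measurable] = T
  have T\<mu> [measurable]: "T \<in> \<mu> \<rightarrow>\<^sub>M borel" using T by (simp cong: measurable_cong_sets add: s\<mu>)
  have bmu: "borel_prob \<mu>" using mu by (simp add: Pp_def)
  have bnu: "borel_prob \<nu>" unfolding \<nu>_def borel_prob_def using M.prob_space_distr[OF T\<mu>] by simp
  have r0: "0 \<le> r" using Tr[of 0] by (metis empty_iff cball_empty not_le)
  show nuP: "\<nu> \<in> Pp p"
  proof -
    have "(\<integral>\<^sup>+ x. ennreal (norm x powr p) \<partial>\<nu>) = (\<integral>\<^sup>+ x. ennreal (norm (T x) powr p) \<partial>\<mu>)"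
      unfolding \<nu>_def by (subst nn_integral_distr) auto
    also have "\<dots> \<le> (\<integral>\<^sup>+ x. ennreal (r powr p) \<partial>\<mu>)"
      using Tr p by (intro nn_integral_mono ennreal_leI powr_mono2) auto
    also have "\<dots> < \<infinity>" by (simp add: M.emeasure_space_1)
    finally show ?thesis using bnu by (simp add: Pp_def)
  qed
  have cost_meas [measurable]: "(\<lambda>z. cost (fst z) (snd z)) \<in> borel \<Otimes>\<^sub>M borel \<rightarrow>\<^sub>M borel"
    unfolding cost_def by measurable
  define m where "m = (\<lambda>x. cost x (T x))"
  have [measurable]: "m \<in> borel_measurable borel" unfolding m_def cost_def by measurable
  define C where "C = (\<lambda>\<eta>. (\<integral>z. cost (fst z) (snd z) \<partial>\<eta>))"
  have cint: "integrable \<eta> (\<lambda>z. cost (fst z) (snd z))"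
    and Ceq: "C \<eta> = l * (\<integral>z. norm (fst z - snd z) powr p \<partial>\<eta>) + a * (\<integral>z. norm (z - z2) powr p \<partial>\<nu>') + b * (\<integral>z. norm (z - z3) powr p \<partial>\<nu>')"
    if "\<nu>' \<in> Pp p" "\<eta> \<in> couplings \<mu> \<nu>'" for \<nu>' \<eta>
  proof -
    note i = couplings_integrable[OF that(2) mu that(1) p0(2)]
    note c = couplingsD[OF that(2)]
    have [measurable_cong]: "sets \<eta> = sets (borel \<Otimes>\<^sub>M borel)" using c by simp
    show "integrable \<eta> (\<lambda>z. cost (fst z) (snd z))"
      unfolding cost_def using i by (intro Bochner_Integration.integrable_add integrable_mult_right) auto
    have "(\<integral>z. norm (z - w) powr p \<partial>\<nu>') = (\<integral>z. norm (snd z - w) powr p \<partial>\<eta>)" for w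
      unfolding c(4) by (subst integral_distr) auto
    then show "C \<eta> = l * (\<integral>z. norm (fst z - snd z) powr p \<partial>\<eta>) + a * (\<integral>z. norm (z - z2) powr p \<partial>\<nu>') + b * (\<integral>z. norm (z - z3) powr p \<partial>\<nu>')"
      unfolding C_def cost_def using i by simp
  qed
  \<comment> \<open>The coupling carried by the graph of \<open>T\<close>. Its total cost bounds the
    functional at \<nu> from above, while the pointwise gap bounds the total cost of every competing
    coupling from below by the same number.\<close>
  define \<eta>0 where "\<eta>0 = distr \<mu> (borel \<Otimes>\<^sub>M borel) (\<lambda>x. (x, T x))"
  have \<eta>0: "\<eta>0 \<in> couplings \<mu> \<nu>"
  proof -
    have "distr \<eta>0 borel fst = \<mu>" unfolding \<eta>0_def
      by (subst distr_distr) (auto simp: comp_def distr_id2 s\<mu>)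
    moreover have "distr \<eta>0 borel snd = \<nu>" unfolding \<eta>0_def \<nu>_def
      by (subst distr_distr) (auto simp: comp_def)
    moreover have "prob_space \<eta>0" unfolding \<eta>0_def by (rule M.prob_space_distr) auto
    moreover have "sets \<eta>0 = sets borel" unfolding \<eta>0_def borel_prod[symmetric] by simp
    ultimately show ?thesis by (simp add: couplings_def borel_prob_def)
  qed
  have mint: "integrable \<mu> m"
  proof -
    have "integrable \<mu> (\<lambda>x. cost (fst (x, T x)) (snd (x, T x)))"
      by (rule integrable_distr[where M' = "borel \<Otimes>\<^sub>M borel" and T = "\<lambda>x. (x, T x)", of \<mu> "\<lambda>z. cost (fst z) (snd z)"])
         (use cint[OF nuP \<eta>0] in \<open>simp_all add: \<eta>0_def\<close>)
    then show ?thesis by (simp add: m_def)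
  qed
  define M where "M = (\<integral>x. m x \<partial>\<mu>)"
  have C0: "C \<eta>0 = M"
    unfolding C_def \<eta>0_def M_def m_def by (subst integral_distr) auto
  have FM: "F \<nu> \<le> M"
    using Ceq[OF nuP \<eta>0] wasserstein_le[OF \<eta>0 p0(1)] pos unfolding C0 F_def by (simp add: mult_left_mono)
  have gapI: "integrable \<eta> (\<lambda>z. cost (fst z) (snd z) - m (fst z))"
      "(\<integral>z. cost (fst z) (snd z) - m (fst z) \<partial>\<eta>) = C \<eta> - M"
      "AE z in \<eta>. fst z \<in> K"
      "AE z in \<eta>. a * breg p (T (fst z) - z2) (snd z - z2) \<le> cost (fst z) (snd z) - m (fst z)"
    if "\<nu>' \<in> Pp p" "\<eta> \<in> couplings \<mu> \<nu>'" for \<nu>' \<eta>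
  proof -
    note c = couplingsD[OF that(2)]
    have [measurable_cong]: "sets \<eta> = sets (borel \<Otimes>\<^sub>M borel)" using c by simp
    have i: "integrable \<eta> (\<lambda>z. m (fst z))"
      by (rule integrable_distr[where M' = borel and T = fst]) (use mint c(3) in auto)
    then show "integrable \<eta> (\<lambda>z. cost (fst z) (snd z) - m (fst z))"
      using cint[OF that] by simp
    have "M = (\<integral>z. m (fst z) \<partial>\<eta>)"
      unfolding M_def by (subst c(3), subst integral_distr) auto
    then show "(\<integral>z. cost (fst z) (snd z) - m (fst z) \<partial>\<eta>) = C \<eta> - M"
      using i cint[OF that] by (simp add: C_def)
    show aeK: "AE z in \<eta>. fst z \<in> K"
      using K unfolding c(3) by (rule AE_distrD[rotated]) auto
    then show "AE z in \<eta>. a * breg p (T (fst z) - z2) (snd z - z2) \<le> cost (fst z) (snd z) - m (fst z)"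
    proof eventually_elim
      case (elim z)
      then show ?case using gap[of "fst z" "snd z"] by (simp add: m_def)
    qed
  qed
  have CM: "M \<le> C \<eta>" if "\<nu>' \<in> Pp p" "\<eta> \<in> couplings \<mu> \<nu>'" for \<nu>' \<eta>
  proof -
    have "0 \<le> (\<integral>z. cost (fst z) (snd z) - m (fst z) \<partial>\<eta>)"
    proof (rule integral_nonneg_AE, use gapI(4)[OF that] in eventually_elim)
      case (elim z)
      then show ?case using breg_nonneg[OF p, of "T (fst z) - z2" "snd z - z2"] pos by (smt (verit) mult_nonneg_nonneg)
    qed
    then show ?thesis using gapI(2)[OF that] by simp
  qed
  have approx: "\<exists>\<eta>\<in>couplings \<mu> \<nu>'. C \<eta> \<le> F \<nu>' + e" if "\<nu>' \<in> Pp p" "0 < e" for \<nu>' e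
  proof -
    have "couplings \<mu> \<nu>' \<noteq> {}" using couplings_nonempty[OF bmu, of \<nu>'] that by (auto simp: Pp_def)
    moreover have el: "0 < e / l" using that pos by simp
    ultimately obtain \<eta> where \<eta>: "\<eta> \<in> couplings \<mu> \<nu>'"
        "(\<integral>z. norm (fst z - snd z) powr p \<partial>\<eta>) < wasserstein p \<mu> \<nu>' powr p + e / l"
      using wasserstein_approx[OF _ p0(1) el] by blast
    have "l * (\<integral>z. norm (fst z - snd z) powr p \<partial>\<eta>) \<le> l * (wasserstein p \<mu> \<nu>' powr p + e / l)"
      using \<eta>(2) pos by (intro mult_left_mono) auto
    then have "C \<eta> \<le> F \<nu>' + e" unfolding Ceq[OF that(1) \<eta>(1)] F_def using pos by (simp add: distrib_left)
    then show ?thesis using \<eta>(1) by blast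
  qed
  show le: "F \<nu> \<le> F \<nu>'" if "\<nu>' \<in> Pp p" for \<nu>'
  proof -
    have "M \<le> F \<nu>' + e" if "0 < e" for e
      using approx[OF \<open>\<nu>' \<in> Pp p\<close> that] CM[OF \<open>\<nu>' \<in> Pp p\<close>] by (meson order_trans)
    then have "M \<le> F \<nu>'" by (rule field_le_epsilon)
    then show ?thesis using FM by simp
  qed
  show "\<nu>' = \<nu>" if nu': "\<nu>' \<in> Pp p" and min: "F \<nu>' \<le> F \<nu>" for \<nu>'
  proof (rule sym, rule couplings_close_imp_eq[OF bnu])
    show "borel_prob \<nu>'" using nu' by (simp add: Pp_def)
    fix \<epsilon> e :: real assume \<epsilon>: "0 < \<epsilon>" and e: "0 < e"
    \<comment> \<open>The values of \<open>T\<close> stay in a fixed ball, so the Bregman gap at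
      distance \<epsilon> is bounded below uniformly in the first coordinate.\<close>
    obtain \<delta> where \<delta>: "0 < \<delta>" "\<And>w z. w \<in> cball (- z2) r \<Longrightarrow> \<epsilon> \<le> norm (z - w) \<Longrightarrow> \<delta> \<le> breg p w z"
      using breg_unif_pos[OF p \<epsilon>, of "- z2" r] by blast
    have "0 < a * \<delta> * e" using \<delta> pos e by simp
    then obtain \<eta> where \<eta>: "\<eta> \<in> couplings \<mu> \<nu>'" "C \<eta> \<le> F \<nu>' + a * \<delta> * e" using approx[OF nu'] by blast
    note c = couplingsD[OF \<eta>(1)]
    interpret E: prob_space \<eta> by (rule c)
    have s\<eta> [measurable_cong]: "sets \<eta> = sets (borel \<Otimes>\<^sub>M borel)" using c by simp
    have sp: "space \<eta> = UNIV" using c(2)[THEN sets_eq_imp_space_eq] by (simp add: space_pair_measure)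
    define D where "D = (\<lambda>z. cost (fst z) (snd z) - m (fst z))"
    have [measurable]: "D \<in> borel_measurable \<eta>" unfolding D_def by measurable
    have D0: "AE z in \<eta>. 0 \<le> D z"
      using gapI(4)[OF nu' \<eta>(1)]
    proof eventually_elim
      case (elim z)
      then show ?case using breg_nonneg[OF p, of "T (fst z) - z2" "snd z - z2"] pos unfolding D_def by (smt (verit) mult_nonneg_nonneg)
    qed
    \<comment> \<open>Near-optimality of \<eta> and minimality of \<nu>' bound the mean excess cost;
      Markov's inequality then bounds the mass where the excess is at least a * \<delta>.\<close>
    have Dle: "(\<integral>z. D z \<partial>\<eta>) \<le> a * \<delta> * e"
      using gapI(2)[OF nu' \<eta>(1)] \<eta>(2) min FM unfolding D_def by linarith
    have "measure \<eta> {z\<in>space \<eta>. a * \<delta> \<le> D z} \<le> (\<integral>z. D z \<partial>\<eta>) / (a * \<delta>)"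
      using gapI(1)[OF nu' \<eta>(1)] D0 pos \<delta> unfolding D_def
      by (intro integral_Markov_inequality_measure[where A = "{}"]) auto
    also have "\<dots> \<le> e" using Dle pos \<delta> by (simp add: field_simps)
    finally have Mk: "measure \<eta> {z\<in>space \<eta>. a * \<delta> \<le> D z} \<le> e" .
    \<comment> \<open>Replacing x by T x in the first coordinate turns a coupling of \<mu> and
      \<nu>' into one of \<nu> and \<nu>' that is concentrated near the diagonal.\<close>
    let ?f = "\<lambda>z. (T (fst z), snd z)"
    have f [measurable]: "?f \<in> \<eta> \<rightarrow>\<^sub>M borel" unfolding borel_prod[symmetric] by measurable
    have fs: "(fst :: 'a \<times> 'a \<Rightarrow> 'a) \<in> borel \<rightarrow>\<^sub>M borel" "(snd :: 'a \<times> 'a \<Rightarrow> 'a) \<in> borel \<rightarrow>\<^sub>M borel"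
      unfolding borel_prod[symmetric] by measurable
    have "distr (distr \<eta> borel ?f) borel fst = \<nu>"
      unfolding distr_distr[OF fs(1) f] \<nu>_def comp_def fst_conv
      by (subst c(3), subst distr_distr) (auto simp: comp_def)
    moreover have "distr (distr \<eta> borel ?f) borel snd = \<nu>'"
      unfolding distr_distr[OF fs(2) f] comp_def snd_conv using c(4) by simp
    ultimately have "distr \<eta> borel ?f \<in> couplings \<nu> \<nu>'"
      using E.prob_space_distr[OF f] by (simp add: couplings_def borel_prob_def)
    moreover have "measure (distr \<eta> borel ?f) {z. \<epsilon> \<le> dist (fst z) (snd z)} \<le> e"
    proof -
      have cl: "closed {z::'a\<times>'a. \<epsilon> \<le> dist (fst z) (snd z)}" by (intro closed_Collect_le continuous_intros)
      have "measure (distr \<eta> borel ?f) {z. \<epsilon> \<le> dist (fst z) (snd z)} = measure \<eta> {z. \<epsilon> \<le> dist (T (fst z)) (snd z)}"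
        using cl by (subst measure_distr[OF f]) (auto simp: sp)
      also have "\<dots> \<le> measure \<eta> {z\<in>space \<eta>. a * \<delta> \<le> D z}"
      proof (rule E.finite_measure_mono_AE)
        show "AE z in \<eta>. z \<in> {z. \<epsilon> \<le> dist (T (fst z)) (snd z)} \<longrightarrow> z \<in> {z\<in>space \<eta>. a * \<delta> \<le> D z}"
          using gapI(4)[OF nu' \<eta>(1)]
        proof (eventually_elim, intro impI)
          fix z assume z: "a * breg p (T (fst z) - z2) (snd z - z2) \<le> cost (fst z) (snd z) - m (fst z)"
            "z \<in> {z. \<epsilon> \<le> dist (T (fst z)) (snd z)}"
          have "\<delta> \<le> breg p (T (fst z) - z2) (snd z - z2)"
            using z(2) Tr[of "fst z"] by (intro \<delta>(2)) (auto simp: dist_norm norm_minus_commute)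
          then have "a * \<delta> \<le> a * breg p (T (fst z) - z2) (snd z - z2)" using pos by (intro mult_left_mono) auto
          then show "z \<in> {z\<in>space \<eta>. a * \<delta> \<le> D z}" using z(1) by (simp add: D_def sp)
        qed
        show "{z\<in>space \<eta>. a * \<delta> \<le> D z} \<in> sets \<eta>" by measurable
      qed
      finally show ?thesis using Mk by simp
    qed
    ultimately show "\<exists>\<eta>\<in>couplings \<nu> \<nu>'. measure \<eta> {z. \<epsilon> \<le> dist (fst z) (snd z)} \<le> e" by blast
  qed
qed

section \<open>The singular map\<close>

text \<open>A derivative-free form of "stretches like \<rho>^(-\<alpha>)": bi-Lipschitz on every
  small shell with constants uniform in \<rho>. The radius is existential so that it may shrink
  under sums and compositions.\<close>

definition bilip_sing :: "real \<Rightarrow> ('a::real_normed_vector \<Rightarrow> 'a) \<Rightarrow> bool" where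
  "bilip_sing \<alpha> \<Phi> \<longleftrightarrow> (\<exists>r>0. \<exists>c1>0. \<exists>c2>0. \<forall>\<rho> y z. 0 < \<rho> \<longrightarrow> \<rho> \<le> r \<longrightarrow>
     norm y \<in> {\<rho>/2..\<rho>} \<longrightarrow> norm z \<in> {\<rho>/2..\<rho>} \<longrightarrow>
     c1 * \<rho> powr (- \<alpha>) * norm (y - z) \<le> norm (\<Phi> y - \<Phi> z) \<and>
     norm (\<Phi> y - \<Phi> z) \<le> c2 * \<rho> powr (- \<alpha>) * norm (y - z))"

lemma bilip_singI:
  assumes "0 < r" "0 < c1" "0 < c2"
    "\<And>\<rho> y z. \<lbrakk>0 < \<rho>; \<rho> \<le> r; norm y \<in> {\<rho>/2..\<rho>}; norm z \<in> {\<rho>/2..\<rho>}\<rbrakk> \<Longrightarrow> c1 * \<rho> powr (- \<alpha>) * norm (y - z) \<le> norm (\<Phi> y - \<Phi> z)"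
    "\<And>\<rho> y z. \<lbrakk>0 < \<rho>; \<rho> \<le> r; norm y \<in> {\<rho>/2..\<rho>}; norm z \<in> {\<rho>/2..\<rho>}\<rbrakk> \<Longrightarrow> norm (\<Phi> y - \<Phi> z) \<le> c2 * \<rho> powr (- \<alpha>) * norm (y - z)"
  shows "bilip_sing \<alpha> \<Phi>"
  unfolding bilip_sing_def using assms by blast

lemma bilip_singE:
  assumes "bilip_sing \<alpha> \<Phi>"
  obtains r c1 c2 where "0 < r" "0 < c1" "0 < c2"
    "\<And>\<rho> y z. \<lbrakk>0 < \<rho>; \<rho> \<le> r; norm y \<in> {\<rho>/2..\<rho>}; norm z \<in> {\<rho>/2..\<rho>}\<rbrakk> \<Longrightarrow> c1 * \<rho> powr (- \<alpha>) * norm (y - z) \<le> norm (\<Phi> y - \<Phi> z)"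
    "\<And>\<rho> y z. \<lbrakk>0 < \<rho>; \<rho> \<le> r; norm y \<in> {\<rho>/2..\<rho>}; norm z \<in> {\<rho>/2..\<rho>}\<rbrakk> \<Longrightarrow> norm (\<Phi> y - \<Phi> z) \<le> c2 * \<rho> powr (- \<alpha>) * norm (y - z)"
  using assms unfolding bilip_sing_def by blast

lemma bilip_sing_add_lipschitz:
  assumes \<Phi>: "bilip_sing \<alpha> \<Phi>" and \<alpha>: "0 < \<alpha>" and r': "0 < r'"
    and L: "\<And>y z. norm y \<le> r' \<Longrightarrow> norm z \<le> r' \<Longrightarrow> norm (\<Psi> y - \<Psi> z) \<le> L * norm (y - z)"
  shows "bilip_sing \<alpha> (\<lambda>y. \<Psi> y + \<Phi> y)"
proof -
  obtain r c1 c2 where r: "0 < r" "0 < c1" "0 < c2"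
    and lo: "\<And>\<rho> y z. \<lbrakk>0 < \<rho>; \<rho> \<le> r; norm y \<in> {\<rho>/2..\<rho>}; norm z \<in> {\<rho>/2..\<rho>}\<rbrakk> \<Longrightarrow> c1 * \<rho> powr (- \<alpha>) * norm (y - z) \<le> norm (\<Phi> y - \<Phi> z)"
    and up: "\<And>\<rho> y z. \<lbrakk>0 < \<rho>; \<rho> \<le> r; norm y \<in> {\<rho>/2..\<rho>}; norm z \<in> {\<rho>/2..\<rho>}\<rbrakk> \<Longrightarrow> norm (\<Phi> y - \<Phi> z) \<le> c2 * \<rho> powr (- \<alpha>) * norm (y - z)"
    using bilip_singE[OF \<Phi>] by metis
  \<comment> \<open>The maximum makes the constant positive, so that it may stand in the denominator
    of \<open>s\<close>, the radius solving c1 / 2 * s powr (- \<alpha>) = L'.\<close>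
  define L' where "L' = max L 1"
  have L': "1 \<le> L'" "L \<le> L'" by (auto simp: L'_def)
  define s where "s = (c1 / (2 * L')) powr (1 / \<alpha>)"
  have s: "0 < s" using r L' by (simp add: s_def)
  \<comment> \<open>below radius \<open>s\<close> the singular term dominates the Lipschitz perturbation\<close>
  have key: "L' \<le> c1 / 2 * \<rho> powr (- \<alpha>)" if "0 < \<rho>" "\<rho> \<le> s" for \<rho>
  proof -
    have "\<rho> powr \<alpha> \<le> s powr \<alpha>" using that \<alpha> by (intro powr_mono2) auto
    also have "s powr \<alpha> = c1 / (2 * L')" using \<alpha> r L' by (simp add: s_def powr_powr)
    finally show ?thesis using that L' by (simp add: powr_minus field_simps)
  qed
  have \<Psi>: "norm (\<Psi> y - \<Psi> z) \<le> L' * norm (y - z)" if "norm y \<le> r'" "norm z \<le> r'" for y z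
    using L[OF that] L' by (meson mult_right_mono norm_ge_zero order_trans)
  show ?thesis
  proof (rule bilip_singI[where r = "min r (min r' s)" and ?c1.0 = "c1 / 2" and ?c2.0 = "c2 + c1 / 2"])
    fix \<rho> :: real and y z :: 'a
    assume h: "0 < \<rho>" "\<rho> \<le> min r (min r' s)" "norm y \<in> {\<rho>/2..\<rho>}" "norm z \<in> {\<rho>/2..\<rho>}"
    have P: "norm (\<Psi> y - \<Psi> z) \<le> c1 / 2 * \<rho> powr (- \<alpha>) * norm (y - z)"
      using \<Psi>[of y z] key[of \<rho>] h by (smt (verit) atLeastAtMost_iff min.bounded_iff mult_right_mono norm_ge_zero)
    have eq: "\<Psi> y + \<Phi> y - (\<Psi> z + \<Phi> z) = (\<Phi> y - \<Phi> z) + (\<Psi> y - \<Psi> z)" by simp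
    have "norm (\<Phi> y - \<Phi> z) - norm (\<Psi> y - \<Psi> z) \<le> norm (\<Psi> y + \<Phi> y - (\<Psi> z + \<Phi> z))"
      unfolding eq by (rule norm_diff_ineq)
    then show "c1 / 2 * \<rho> powr (- \<alpha>) * norm (y - z) \<le> norm (\<Psi> y + \<Phi> y - (\<Psi> z + \<Phi> z))"
      using P lo[of \<rho> y z] h by auto
    have "norm (\<Psi> y + \<Phi> y - (\<Psi> z + \<Phi> z)) \<le> norm (\<Phi> y - \<Phi> z) + norm (\<Psi> y - \<Psi> z)"
      unfolding eq by (rule norm_triangle_ineq)
    then show "norm (\<Psi> y + \<Phi> y - (\<Psi> z + \<Phi> z)) \<le> (c2 + c1 / 2) * \<rho> powr (- \<alpha>) * norm (y - z)"
      using P up[of \<rho> y z] h by (auto simp: algebra_simps)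
  qed (use r r' s in auto)
qed

lemma bilip_sing_scaleR:
  assumes \<Phi>: "bilip_sing \<alpha> \<Phi>" and a: "0 < a"
  shows "bilip_sing \<alpha> (\<lambda>y. a *\<^sub>R \<Phi> y)"
proof -
  obtain r c1 c2 where r: "0 < r" "0 < c1" "0 < c2"
    and lo: "\<And>\<rho> y z. \<lbrakk>0 < \<rho>; \<rho> \<le> r; norm y \<in> {\<rho>/2..\<rho>}; norm z \<in> {\<rho>/2..\<rho>}\<rbrakk> \<Longrightarrow> c1 * \<rho> powr (- \<alpha>) * norm (y - z) \<le> norm (\<Phi> y - \<Phi> z)"
    and up: "\<And>\<rho> y z. \<lbrakk>0 < \<rho>; \<rho> \<le> r; norm y \<in> {\<rho>/2..\<rho>}; norm z \<in> {\<rho>/2..\<rho>}\<rbrakk> \<Longrightarrow> norm (\<Phi> y - \<Phi> z) \<le> c2 * \<rho> powr (- \<alpha>) * norm (y - z)"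
    using bilip_singE[OF \<Phi>] by metis
  have n: "norm (a *\<^sub>R u - a *\<^sub>R v) = a * norm (u - v)" for u v :: 'a
    using a by (simp flip: scaleR_diff_right)
  show ?thesis
    by (rule bilip_singI[where r = r and ?c1.0 = "a * c1" and ?c2.0 = "a * c2"])
       (use r a lo up in \<open>auto simp: n mult.assoc intro!: mult_left_mono\<close>)
qed

text \<open>A bi-Lipschitz map fixing 0 sends shells of radius \<rho> into shells of comparable
  radius, where \<open>pmap p\<close> stretches by a factor of order \<rho> powr (p - 2).\<close>

lemma bilip_sing_pmap_comp:
  fixes V :: "'a::real_inner \<Rightarrow> 'a"
  assumes p: "1 < p" and r: "0 < r" and c: "0 < c" "c \<le> C"
    and V0: "V 0 = 0"
    and lo: "\<And>y z. norm y \<le> r \<Longrightarrow> norm z \<le> r \<Longrightarrow> c * norm (y - z) \<le> norm (V y - V z)"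
    and up: "\<And>y z. norm y \<le> r \<Longrightarrow> norm z \<le> r \<Longrightarrow> norm (V y - V z) \<le> C * norm (y - z)"
  shows "bilip_sing (2 - p) (\<lambda>y. pmap p (V y))"
proof -
  \<comment> \<open>Ratio of the outer radius C * \<rho> to the inner radius c * \<rho> / 2 of the
    image shell.\<close>
  let ?M = "2 * C / c"
  have M: "1 \<le> ?M" using c by (simp add: field_simps)
  let ?K = "pmap_const (p / (p - 1)) (?M powr (p - 1))"
  have K: "0 < ?K" using M p by (intro pmap_const_pos ge_one_powr_ge_zero) auto
  have e: "(c * \<rho> / 2) powr (p - 2) = (c / 2) powr (p - 2) * \<rho> powr (- (2 - p))" if "0 < \<rho>" for \<rho>
    using c that powr_mult[of "c / 2" \<rho> "p - 2"] by simp
  show ?thesis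
  proof (rule bilip_singI[where r = r and ?c1.0 = "(c / 2) powr (p - 2) / ?K * c" and ?c2.0 = "pmap_const p ?M * (c / 2) powr (p - 2) * C"])
    fix \<rho> :: real and y z :: 'a
    assume h: "0 < \<rho>" "\<rho> \<le> r" "norm y \<in> {\<rho>/2..\<rho>}" "norm z \<in> {\<rho>/2..\<rho>}"
    have Vn: "norm (V w) \<in> {c * \<rho> / 2..?M * (c * \<rho> / 2)}" if "norm w \<in> {\<rho>/2..\<rho>}" for w
    proof -
      have "c * norm w \<le> norm (V w)" "norm (V w) \<le> C * norm w"
        using lo[of w 0] up[of w 0] that h r by (auto simp: V0)
      moreover have "c * (\<rho> / 2) \<le> c * norm w" "C * norm w \<le> C * \<rho>"
        using that c by (auto intro!: mult_left_mono)
      ultimately have "c * \<rho> / 2 \<le> norm (V w)" "norm (V w) \<le> C * \<rho>" by linarith+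
      then show ?thesis using c by simp
    qed
    have yz: "norm y \<le> r" "norm z \<le> r" using h by auto
    have "(c / 2) powr (p - 2) / ?K * c * \<rho> powr (- (2 - p)) * norm (y - z) = (c * \<rho> / 2) powr (p - 2) / ?K * (c * norm (y - z))"
      by (simp add: e[OF h(1)])
    also have "\<dots> \<le> (c * \<rho> / 2) powr (p - 2) / ?K * norm (V y - V z)"
      using lo[OF yz] K by (intro mult_left_mono) auto
    also have "\<dots> \<le> norm (pmap p (V y) - pmap p (V z))"
      using h c M p Vn by (intro pmap_expand_annulus) auto
    finally show "(c / 2) powr (p - 2) / ?K * c * \<rho> powr (- (2 - p)) * norm (y - z) \<le> norm (pmap p (V y) - pmap p (V z))" .
    have "norm (pmap p (V y) - pmap p (V z)) \<le> pmap_const p ?M * (c * \<rho> / 2) powr (p - 2) * norm (V y - V z)"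
      using h c M p Vn by (intro pmap_lipschitz_annulus) auto
    also have "\<dots> \<le> pmap_const p ?M * (c * \<rho> / 2) powr (p - 2) * (C * norm (y - z))"
      using up[OF yz] pmap_const_pos[OF M, of p] by (intro mult_left_mono) auto
    finally show "norm (pmap p (V y) - pmap p (V z)) \<le> pmap_const p ?M * (c / 2) powr (p - 2) * C * \<rho> powr (- (2 - p)) * norm (y - z)"
      unfolding e[OF h(1)] by (simp only: mult_ac)
  qed (use r c K pmap_const_pos[OF M, of p] in auto)
qed

lemma bilip_sing_pmap:
  assumes "1 < p"
  shows "bilip_sing (2 - p) (pmap p :: 'a::real_inner \<Rightarrow> 'a)"
  using bilip_sing_pmap_comp[of p 1 1 1 "\<lambda>y::'a. y"] assms by simp

text \<open>The ball of radius norm w / 2 around \<open>w\<close> lies between the radii norm w / 2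
  and 3 * norm w / 2, whence the ratio 3.\<close>

lemma pmap_local_lipschitz:
  fixes w :: "'a::real_inner"
  assumes "norm (y - w) \<le> norm w / 2" "norm (z - w) \<le> norm w / 2" "w \<noteq> 0"
  shows "norm (pmap r y - pmap r z) \<le> pmap_const r 3 * (norm w / 2) powr (r - 2) * norm (y - z)"
proof (rule pmap_lipschitz_annulus)
  have *: "norm u \<in> {norm w / 2..3 * (norm w / 2)}" if "norm (u - w) \<le> norm w / 2" for u
    using that norm_triangle_ineq2[of w "w - u"] norm_triangle_ineq[of w "u - w"] norm_minus_commute[of u w] by auto
  show "norm y \<in> {norm w / 2..3 * (norm w / 2)}" "norm z \<in> {norm w / 2..3 * (norm w / 2)}"
    using * assms by auto
qed (use assms in auto)

text \<open>Near a nonzero value \<open>pmap p\<close> is bi-Lipschitz, so composing with it changes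
  the constants but not the exponent.\<close>

lemma bilip_sing_outer_pmap:
  fixes V :: "'a::real_inner \<Rightarrow> 'a"
  assumes V: "bilip_sing \<alpha> V" and p: "1 < p" and cont: "isCont V 0" and V0: "V 0 \<noteq> 0"
  shows "bilip_sing \<alpha> (\<lambda>y. pmap p (V y))"
proof -
  let ?h = "norm (V 0) / 2"
  let ?K = "pmap_const (p / (p - 1)) (3 powr (p - 1))"
  have K: "0 < ?K" using p by (intro pmap_const_pos ge_one_powr_ge_zero) auto
  have h: "0 < ?h" using V0 by simp
  obtain d where d: "0 < d" "\<And>y. norm y < d \<Longrightarrow> norm (V y - V 0) < ?h"
    using cont[unfolded continuous_at_eps_delta] h by (metis dist_0_norm dist_norm dist_commute)
  obtain r c1 c2 where r: "0 < r" "0 < c1" "0 < c2"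
    and lo: "\<And>\<rho> y z. \<lbrakk>0 < \<rho>; \<rho> \<le> r; norm y \<in> {\<rho>/2..\<rho>}; norm z \<in> {\<rho>/2..\<rho>}\<rbrakk> \<Longrightarrow> c1 * \<rho> powr (- \<alpha>) * norm (y - z) \<le> norm (V y - V z)"
    and up: "\<And>\<rho> y z. \<lbrakk>0 < \<rho>; \<rho> \<le> r; norm y \<in> {\<rho>/2..\<rho>}; norm z \<in> {\<rho>/2..\<rho>}\<rbrakk> \<Longrightarrow> norm (V y - V z) \<le> c2 * \<rho> powr (- \<alpha>) * norm (y - z)"
    using bilip_singE[OF V] by metis
  have Vn: "norm (V y) \<in> {?h..3 * ?h}" if "norm y < d" for y
    using d(2)[OF that] norm_triangle_ineq2[of "V 0" "V 0 - V y"] norm_triangle_ineq[of "V 0" "V y - V 0"]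
      norm_minus_commute[of "V y" "V 0"] by auto
  show ?thesis
  proof (rule bilip_singI[where r = "min r (d / 2)" and ?c1.0 = "?h powr (p - 2) / ?K * c1" and ?c2.0 = "pmap_const p 3 * ?h powr (p - 2) * c2"])
    fix \<rho> :: real and y z :: 'a
    assume h': "0 < \<rho>" "\<rho> \<le> min r (d / 2)" "norm y \<in> {\<rho>/2..\<rho>}" "norm z \<in> {\<rho>/2..\<rho>}"
    have yz: "norm (V y) \<in> {?h..3 * ?h}" "norm (V z) \<in> {?h..3 * ?h}" 
    proof -
      have "norm y < d" "norm z < d" using h' d(1) by auto
      then show "norm (V y) \<in> {?h..3 * ?h}" "norm (V z) \<in> {?h..3 * ?h}" by (blast intro: Vn)+
    qed
    have "?h powr (p - 2) / ?K * (c1 * \<rho> powr (- \<alpha>) * norm (y - z)) \<le> ?h powr (p - 2) / ?K * norm (V y - V z)"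
      using lo[of \<rho> y z] h' K by (intro mult_left_mono) auto
    also have "\<dots> \<le> norm (pmap p (V y) - pmap p (V z))"
      using h p yz by (intro pmap_expand_annulus) auto
    finally show "?h powr (p - 2) / ?K * c1 * \<rho> powr (- \<alpha>) * norm (y - z) \<le> norm (pmap p (V y) - pmap p (V z))"
      by (simp only: mult.assoc)
    have "norm (pmap p (V y) - pmap p (V z)) \<le> pmap_const p 3 * ?h powr (p - 2) * norm (V y - V z)"
      using h p yz by (intro pmap_lipschitz_annulus) auto
    also have "\<dots> \<le> pmap_const p 3 * ?h powr (p - 2) * (c2 * \<rho> powr (- \<alpha>) * norm (y - z))"
      using up[of \<rho> y z] h' pmap_const_pos[of 3 p] by (intro mult_left_mono) auto
    finally show "norm (pmap p (V y) - pmap p (V z)) \<le> pmap_const p 3 * ?h powr (p - 2) * c2 * \<rho> powr (- \<alpha>) * norm (y - z)"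
      by (simp only: mult.assoc)
  qed (use r d h K V0 pmap_const_pos[of 3 p] in auto)
qed

section \<open>Placing the Dirac masses\<close>

definition dirac_field :: "real \<Rightarrow> real \<Rightarrow> real \<Rightarrow> 'a::real_inner \<Rightarrow> 'a \<Rightarrow> 'a \<Rightarrow> 'a" where
  "dirac_field p a b z2 z3 y = a *\<^sub>R pmap p (y - z2) + b *\<^sub>R pmap p (y - z3)"

text \<open>This is 2 - r with r the smaller one of p and its conjugate exponent p / (p -
  1).\<close>

definition sing_exp :: "real \<Rightarrow> real" where
  "sing_exp p = (if p < 2 then 2 - p else (p - 2) / (p - 1))"

lemma sing_exp_bounds:
  assumes "1 < p" "p \<noteq> 2"
  shows "0 < sing_exp p" "sing_exp p < 1"
  using assms by (auto simp: sing_exp_def field_simps)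

text \<open>For p < 2 one mass sits at the origin and the other pulls there with nonzero force. For
  p > 2 the two sit on opposite sides of the origin, where their pulls cancel.\<close>

lemma exists_bilip_sing:
  assumes p: "1 < p" "p \<noteq> 2" and a: "0 < a" and b: "0 < b"
  shows "\<exists>z2 z3 :: 'a::euclidean_space. bilip_sing (sing_exp p) (\<lambda>y. y + pmap (p / (p - 1)) (dirac_field p a b z2 z3 y))"
proof -
  obtain e :: 'a where e: "norm e = 1" using SOME_Basis norm_Basis by blast
  then have e0: "e \<noteq> 0" by auto
  have p': "1 < p / (p - 1)" using p by (simp add: field_simps)
  have \<alpha>: "0 < sing_exp p" using sing_exp_bounds[OF p] by simp
  \<comment> \<open>The identity is a Lipschitz perturbation, so only the composed power map has to
    be singular.\<close>
  have fin: ?thesis if "bilip_sing (sing_exp p) (\<lambda>y::'a. pmap (p / (p - 1)) (dirac_field p a b z2 z3 y))" for z2 z3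
    using bilip_sing_add_lipschitz[OF that \<alpha>, of 1 "\<lambda>y. y" 1] by auto
  show ?thesis
  proof (cases "p < 2")
    case True
    have s: "sing_exp p = 2 - p" using True by (simp add: sing_exp_def)
    let ?V = "dirac_field p a b 0 e"
    \<comment> \<open>The mass at 0 supplies the singularity; the field of the mass at
      \<open>e\<close> is Lipschitz on the ball of radius 1/2.\<close>
    have "bilip_sing (2 - p) (\<lambda>y. b *\<^sub>R pmap p (y - e) + a *\<^sub>R pmap p y)"
    proof (rule bilip_sing_add_lipschitz[where r' = "1/2" and L = "b * (pmap_const p 3 * (1 / 2) powr (p - 2))"])
      show "bilip_sing (2 - p) (\<lambda>y::'a. a *\<^sub>R pmap p y)" by (intro bilip_sing_scaleR bilip_sing_pmap p a)
      fix y z :: 'a assume "norm y \<le> 1/2" "norm z \<le> 1/2"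
      then have "norm (pmap p (y - e) - pmap p (z - e)) \<le> pmap_const p 3 * (1 / 2) powr (p - 2) * norm (y - z)"
        using pmap_local_lipschitz[of "y - e" "- e" "z - e" p] e e0 by simp
      then show "norm (b *\<^sub>R pmap p (y - e) - b *\<^sub>R pmap p (z - e)) \<le> b * (pmap_const p 3 * (1 / 2) powr (p - 2)) * norm (y - z)"
        using b by (simp add: mult.assoc flip: scaleR_diff_right)
    qed (use True in auto)
    then have "bilip_sing (2 - p) ?V" by (simp add: dirac_field_def[abs_def] add.commute)
    moreover have "continuous_on UNIV ?V"
      unfolding dirac_field_def[abs_def] using p by (intro continuous_intros)
    then have "isCont ?V 0" by (simp add: continuous_on_eq_continuous_at)
    moreover have "?V 0 \<noteq> 0" using e e0 b by (simp add: dirac_field_def pmap_def)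
    ultimately have "bilip_sing (2 - p) (\<lambda>y. pmap (p / (p - 1)) (?V y))"
      using p' by (intro bilip_sing_outer_pmap)
    then show ?thesis using fin s by simp
  next
    case False
    then have p2: "2 < p" using p by simp
    have s: "sing_exp p = 2 - p / (p - 1)" using p2 by (simp add: sing_exp_def field_simps)
    let ?s = "a powr (- 1 / (p - 1))" and ?u = "b powr (- 1 / (p - 1))"
    \<comment> \<open>the scaling puts the zero of the vector field at the origin\<close>
    define z2 where "z2 = - (?s *\<^sub>R e)"
    define z3 where "z3 = ?u *\<^sub>R e"
    have n: "norm z2 = ?s" "norm z3 = ?u" using e by (auto simp: z2_def z3_def)
    have su: "0 < ?s" "0 < ?u" using a b by auto
    let ?V = "dirac_field p a b z2 z3"
    \<comment> \<open>A mass of weight t at distance t powr (- 1 / (p - 1)) pulls with force t *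
      distance powr (p - 1) = 1.\<close>
    have sp: "t * (t powr (- 1 / (p - 1))) powr (p - 2) * t powr (- 1 / (p - 1)) = 1" if "0 < t" for t :: real
    proof -
      have "t * (t powr (- 1 / (p - 1))) powr (p - 2) * t powr (- 1 / (p - 1)) = t powr (1 + (- 1 / (p - 1)) * (p - 2) + (- 1 / (p - 1)))"
        using that by (simp only: powr_add powr_powr powr_one)
      also have "1 + (- 1 / (p - 1)) * (p - 2) + (- 1 / (p - 1)) = 0" using p by (simp add: field_simps)
      finally show ?thesis using that by simp
    qed
    have V0: "?V 0 = 0"
    proof -
      have "?V 0 = (a * ?s powr (p - 2) * ?s) *\<^sub>R e - (b * ?u powr (p - 2) * ?u) *\<^sub>R e"
        by (simp add: dirac_field_def pmap_def n) (simp add: z2_def z3_def)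
      then show ?thesis using sp[OF a] sp[OF b] by simp
    qed
    \<comment> \<open>Half the distance to the nearer mass, so that both pulls are Lipschitz on the
      ball.\<close>
    define r where "r = min (?s / 2) (?u / 2)"
    have r: "0 < r" using su by (simp add: r_def)
    define C2 where "C2 = pmap_const p 3 * (?s / 2) powr (p - 2)"
    define C3 where "C3 = pmap_const p 3 * (?u / 2) powr (p - 2)"
    define c where "c = a * (?s / 2) powr (p - 2)"
    have c: "0 < c" using a su by (simp add: c_def)
    have z0: "z2 \<noteq> 0" "z3 \<noteq> 0" using n su by auto
    have up: "norm (?V y - ?V z) \<le> (a * C2 + b * C3) * norm (y - z)" if h: "norm y \<le> r" "norm z \<le> r" for y z
    proof -
      have 1: "norm (pmap p (y - z2) - pmap p (z - z2)) \<le> C2 * norm (y - z)"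
        using pmap_local_lipschitz[of "y - z2" "- z2" "z - z2" p] h z0 n by (simp add: r_def C2_def)
      have 2: "norm (pmap p (y - z3) - pmap p (z - z3)) \<le> C3 * norm (y - z)"
        using pmap_local_lipschitz[of "y - z3" "- z3" "z - z3" p] h z0 n by (simp add: r_def C3_def)
      have "?V y - ?V z = a *\<^sub>R (pmap p (y - z2) - pmap p (z - z2)) + b *\<^sub>R (pmap p (y - z3) - pmap p (z - z3))"
        by (simp add: dirac_field_def algebra_simps)
      then have "norm (?V y - ?V z) \<le> norm (a *\<^sub>R (pmap p (y - z2) - pmap p (z - z2))) + norm (b *\<^sub>R (pmap p (y - z3) - pmap p (z - z3)))"
        by (metis norm_triangle_ineq)
      also have "\<dots> \<le> a * (C2 * norm (y - z)) + b * (C3 * norm (y - z))"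
        using 1 2 a b by (intro add_mono) auto
      finally show ?thesis by (simp add: algebra_simps)
    qed
    \<comment> \<open>The mass at \<open>z2\<close> alone makes the field strongly monotone near 0,
      the one at \<open>z3\<close> adds a nonnegative term, and Cauchy-Schwarz turns monotonicity
      into expansion.\<close>
    have lo: "c * norm (y - z) \<le> norm (?V y - ?V z)" if h: "norm y \<le> r" "norm z \<le> r" for y z
    proof (cases "y = z")
      case False
      have "norm u \<le> r \<Longrightarrow> ?s / 2 \<le> norm (u - z2)" for u
        using norm_triangle_ineq2[of z2 u] n by (simp add: r_def norm_minus_commute)
      then have "(?s / 2) powr (p - 2) \<le> norm (y - z2) powr (p - 2)" "(?s / 2) powr (p - 2) \<le> norm (z - z2) powr (p - 2)"
        using h p2 su by (auto intro!: powr_mono2)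
      then have "(?s / 2) powr (p - 2) \<le> (norm (y - z2) powr (p - 2) + norm (z - z2) powr (p - 2)) / 2" by simp
      then have "(?s / 2) powr (p - 2) * (norm (y - z))\<^sup>2 \<le> (norm (y - z2) powr (p - 2) + norm (z - z2) powr (p - 2)) / 2 * (norm (y - z))\<^sup>2"
        by (intro mult_right_mono) auto
      also have "\<dots> \<le> (pmap p (y - z2) - pmap p (z - z2)) \<bullet> (y - z)"
        using pmap_inner_ge[of p "y - z2" "z - z2"] p2 by simp
      finally have 1: "(?s / 2) powr (p - 2) * (norm (y - z))\<^sup>2 \<le> (pmap p (y - z2) - pmap p (z - z2)) \<bullet> (y - z)" .
      have 2: "0 \<le> (pmap p (y - z3) - pmap p (z - z3)) \<bullet> (y - z)"
        using pmap_inner_ge[of p "y - z3" "z - z3"] p2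
        by (smt (verit) diff_diff_eq2 diff_add_cancel divide_nonneg_nonneg mult_nonneg_nonneg powr_ge_zero zero_le_power2 add_diff_cancel diff_right_commute add.commute)
      have "c * (norm (y - z))\<^sup>2 \<le> a * ((pmap p (y - z2) - pmap p (z - z2)) \<bullet> (y - z))"
        using 1 a by (simp add: c_def)
      also have "\<dots> \<le> a * ((pmap p (y - z2) - pmap p (z - z2)) \<bullet> (y - z)) + b * ((pmap p (y - z3) - pmap p (z - z3)) \<bullet> (y - z))"
        using 2 b by simp
      also have "\<dots> = (?V y - ?V z) \<bullet> (y - z)"
        by (simp add: dirac_field_def inner_diff_left inner_add_left algebra_simps)
      also have "\<dots> \<le> norm (?V y - ?V z) * norm (y - z)" by (rule norm_cauchy_schwarz)
      finally have "c * norm (y - z) * norm (y - z) \<le> norm (?V y - ?V z) * norm (y - z)"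
        by (simp add: power2_eq_square mult.assoc)
      then show ?thesis using False by simp
    qed simp
    define C where "C = max c (a * C2 + b * C3)"
    have "bilip_sing (2 - p / (p - 1)) (\<lambda>y. pmap (p / (p - 1)) (?V y))"
    proof (rule bilip_sing_pmap_comp[where V = ?V and C = C, OF p' r c])
      show "c \<le> C" by (simp add: C_def)
      show "norm (?V y - ?V z) \<le> C * norm (y - z)" if "norm y \<le> r" "norm z \<le> r" for y z
        using up[OF that] mult_right_mono[of "a * C2 + b * C3" C "norm (y - z)"] by (simp add: C_def)
    qed (use lo V0 in auto)
    then show ?thesis using fin s by simp
  qed
qed

text \<open>Each of the three powers is its tangent at \<open>y\<close> plus a Bregman divergence.
  The formula for \<open>x\<close> makes the tangents cancel; of the divergences, all nonnegative up
  to their weights, the one at \<open>z2\<close> is kept.\<close>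

lemma cost_gap:
  fixes y z z2 z3 :: "'a::real_inner"
  assumes p: "1 < p" and pos: "0 < l" "0 < b"
    and x: "x = y + pmap (p / (p - 1)) (dirac_field p (a / l) (b / l) z2 z3 y)"
  shows "l * norm (x - y) powr p + a * norm (y - z2) powr p + b * norm (y - z3) powr p + a * breg p (y - z2) (z - z2)
      \<le> l * norm (x - z) powr p + a * norm (z - z2) powr p + b * norm (z - z3) powr p"
proof -
  let ?v = "dirac_field p (a / l) (b / l) z2 z3 y"
  have "pmap p (x - y) = ?v"
    unfolding x using p by (simp add: pmap_pmap field_simps)
  then have "pmap p (y - x) = - ?v" using pmap_minus[of p "x - y"] by simp
  then have "l *\<^sub>R pmap p (y - x) + a *\<^sub>R pmap p (y - z2) + b *\<^sub>R pmap p (y - z3) = 0"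
    using pos by (simp add: dirac_field_def scaleR_add_right scaleR_diff_right)
  then have "(l *\<^sub>R pmap p (y - x) + a *\<^sub>R pmap p (y - z2) + b *\<^sub>R pmap p (y - z3)) \<bullet> (z - y) = 0"
    by simp
  then have "p * (l * (pmap p (y - x) \<bullet> (z - y)) + a * (pmap p (y - z2) \<bullet> (z - y)) + b * (pmap p (y - z3) \<bullet> (z - y))) = 0"
    by (simp add: inner_add_left)
  moreover have "0 \<le> l * breg p (y - x) (z - x)" "0 \<le> b * breg p (y - z3) (z - z3)"
    using breg_nonneg[OF p, of "y - x" "z - x"] breg_nonneg[OF p, of "y - z3" "z - z3"] pos by simp_all
  ultimately show ?thesis
    by (simp add: breg_def norm_minus_commute[of x] algebra_simps)
qed

section \<open>The uniform first measure and the assembled construction\<close>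

lemma Pp_uniform_compact:
  fixes K :: "'a::euclidean_space set"
  assumes K: "compact K" and pos: "0 < emeasure lborel K" and p: "0 < p"
  shows "uniform_measure lborel K \<in> Pp p"
proof -
  have [measurable]: "K \<in> sets borel" using K by (simp add: borel_compact)
  have fin: "emeasure lborel K < \<infinity>" using emeasure_compact_finite[OF K] .
  interpret prob_space "uniform_measure lborel K"
    using pos fin by (intro prob_space_uniform_measure) auto
  obtain B where B: "\<And>x. x \<in> K \<Longrightarrow> norm x \<le> B" using compact_imp_bounded[OF K] by (auto simp: bounded_iff)
  have "AE x in uniform_measure lborel K. x \<in> K" by (rule AE_uniform_measureI) auto
  then have "(\<integral>\<^sup>+ x. ennreal (norm x powr p) \<partial>uniform_measure lborel K) \<le> (\<integral>\<^sup>+ x. ennreal (B powr p) \<partial>uniform_measure lborel K)"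
    by (intro nn_integral_mono_AE, eventually_elim) (use B p in \<open>auto intro!: ennreal_leI powr_mono2\<close>)
  also have "\<dots> < \<infinity>" using emeasure_space_1 by simp
  finally show ?thesis using prob_space_axioms by (simp add: Pp_def borel_prob_def)
qed

lemma uniform_measure_has_density:
  fixes K :: "'a::euclidean_space set"
  assumes K: "K \<in> sets borel" and pos: "0 < emeasure lborel K" and fin: "emeasure lborel K < \<infinity>"
  shows "\<exists>f. has_lebesgue_density (uniform_measure lborel K) f \<and> in_Lq \<infinity> f"
proof -
  define m where "m = measure lborel K"
  have m: "emeasure lborel K = ennreal m" using fin by (simp add: m_def emeasure_eq_ennreal_measure)
  then have m0: "0 < m" using pos by simp
  define f where "f = (\<lambda>x. indicator K x / m :: real)"
  have [measurable]: "f \<in> borel_measurable borel" unfolding f_def using K by measurable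
  have "has_lebesgue_density (uniform_measure lborel K) f"
    unfolding has_lebesgue_density_def
  proof (intro conjI allI)
    show "uniform_measure lborel K = density lborel (\<lambda>x. ennreal (f x))"
    proof -
      have "indicator K x / ennreal m = ennreal (f x)" for x
        using m0 divide_ennreal[of 1 m] by (cases "x \<in> K") (simp_all add: f_def)
      then show ?thesis by (simp add: uniform_measure_def m)
    qed
    show "f \<in> borel_measurable borel" by fact
    show "0 \<le> f x" for x using m0 by (simp add: f_def)
  qed
  moreover have "in_Lq \<infinity> f"
    unfolding in_Lq_def using m0 \<open>f \<in> borel_measurable borel\<close> by (auto simp: f_def indicator_def intro!: exI[of _ "1 / m"])
  ultimately show ?thesis by blast
qed

theorem theorem1p2:
  fixes p :: real
  assumes "1 < p" and "p \<noteq> 2"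
  shows "\<exists>q0::real. q0 > 1 \<and>
    (\<forall>(N::nat) (w :: nat \<Rightarrow> real).
       N > 2 \<longrightarrow> (\<forall>i\<in>{1..N}. w i > 0) \<longrightarrow> (\<Sum>i=1..N. w i) = 1 \<longrightarrow>
       (\<exists>\<mu> :: nat \<Rightarrow> (real ^ 'n::finite) measure.
          (\<forall>i\<in>{1..N}. borel_prob (\<mu> i) \<and> compact (msupport (\<mu> i))) \<and>
          (\<exists>f. has_lebesgue_density (\<mu> 1) f \<and> in_Lq \<infinity> f) \<and>
          (\<exists>\<nu> g. is_wasserstein_barycenter p N \<mu> w \<nu> \<and>
                 (\<forall>\<nu>'. is_wasserstein_barycenter p N \<mu> w \<nu>' \<longrightarrow> \<nu>' = \<nu>) \<and>
                 has_lebesgue_density \<nu> g \<and>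
                 (\<forall>q::ereal. q \<ge> 1 \<longrightarrow> (in_Lq q g \<longleftrightarrow> q < ereal q0)) \<and>
                 (\<forall>q::ereal. q \<ge> ereal q0 \<longrightarrow> \<not> in_Lq q g))))"
proof (intro exI[of _ "1 / sing_exp p"] conjI allI impI)
  have p: "1 < p" "p \<noteq> 2" and p0: "0 < p" using assms by auto
  have \<alpha>: "0 < sing_exp p" "sing_exp p < 1" using sing_exp_bounds[OF p] by auto
  show q1: "1 < 1 / sing_exp p" using \<alpha> by simp
  fix N :: nat and w :: "nat \<Rightarrow> real"
  assume N: "N > 2" and w: "\<forall>i\<in>{1..N}. w i > 0"
  define l where "l = w 1"
  define a where "a = w 2"
  \<comment> \<open>All masses from index 3 on share one point, so their weights add up; N > 2 makes
    the sum nonempty.\<close>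
  define b where "b = (\<Sum>i=3..N. w i)"
  have pos: "0 < l" "0 < a" "0 < b"
    using w N by (auto simp: l_def a_def b_def intro!: sum_pos)
  obtain z2 z3 :: "real ^ 'n" where
    bs: "bilip_sing (sing_exp p) (\<lambda>y. y + pmap (p / (p - 1)) (dirac_field p (a / l) (b / l) z2 z3 y))"
    using exists_bilip_sing[OF p, of "a / l" "b / l"] pos by auto
  define S where "S = (\<lambda>y. y + pmap (p / (p - 1)) (dirac_field p (a / l) (b / l) z2 z3 y))"
  obtain r c1 c2 where r: "0 < r" and c: "0 < c1" "0 < c2"
    and lo: "\<And>\<rho> y z. \<lbrakk>0 < \<rho>; \<rho> \<le> r; norm y \<in> {\<rho>/2..\<rho>}; norm z \<in> {\<rho>/2..\<rho>}\<rbrakk> \<Longrightarrow> c1 * \<rho> powr (- sing_exp p) * norm (y - z) \<le> norm (S y - S z)"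
    and up: "\<And>\<rho> y z. \<lbrakk>0 < \<rho>; \<rho> \<le> r; norm y \<in> {\<rho>/2..\<rho>}; norm z \<in> {\<rho>/2..\<rho>}\<rbrakk> \<Longrightarrow> norm (S y - S z) \<le> c2 * \<rho> powr (- sing_exp p) * norm (y - z)"
    using bilip_singE[OF bs[folded S_def]] by metis
  define cost where "cost = (\<lambda>x z. l * norm (x - z) powr p + a * norm (z - z2) powr p + b * norm (z - z3) powr p)"
  have gapS: "cost (S y) y + a * breg p (y - z2) (z - z2) \<le> cost (S y) z" for y z
    unfolding cost_def using cost_gap[OF p(1) pos(1,3), of "S y" y a z2 z3 z] by (simp add: S_def)
  \<comment> \<open>If two points had the same image under \<open>S\<close>, each would be strictly
    cheaper than the other for it.\<close>
  have injS: "inj S"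
  proof (rule injI, rule ccontr)
    fix y z assume eq: "S y = S z" and ne: "y \<noteq> z"
    have "0 < a * breg p (y - z2) (z - z2)" "0 < a * breg p (z - z2) (y - z2)"
      using ne pos p by (auto intro!: mult_pos_pos breg_pos)
    then show False using gapS[of y z] gapS[of z y] eq by simp
  qed
  have contS: "continuous_on A S" for A
  proof -
    have "1 < p / (p - 1)" using p by (simp add: field_simps)
    then show ?thesis unfolding S_def dirac_field_def using p by (intro continuous_intros)
  qed
  define K where "K = S ` cball 0 r"
  have K: "compact K" unfolding K_def by (intro compact_continuous_image contS) auto
  have Kb: "K \<in> sets borel" using K by (simp add: borel_compact)
  \<comment> \<open>The default value 0 lies in the ball, so the range of \<open>T\<close> stays
    bounded off \<open>K\<close> too.\<close>
  define T where "T = (\<lambda>x. if x \<in> K then inv_into (cball 0 r) S x else 0)"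
  have TS: "T (S y) = y" if "y \<in> cball 0 r" for y
    using that injS by (auto simp: T_def K_def intro!: inv_into_f_f inj_on_subset[OF injS])
  have Tr: "T x \<in> cball 0 r" for x
    using r inv_into_into[of x S "cball 0 r"] by (auto simp: T_def K_def simp del: mem_cball_0)
  have T: "T \<in> borel_measurable borel"
    unfolding T_def
  proof (rule borel_measurable_continuous_on_if[OF Kb])
    \<comment> \<open>A continuous injection on a compact set has a continuous inverse.\<close>
    show "continuous_on K (inv_into (cball 0 r) S)"
      unfolding K_def by (rule continuous_on_inv[OF contS]) (auto intro!: inv_into_f_f inj_on_subset[OF injS])
  qed auto
  note pd = pushforward_density[OF r \<alpha>(1) c contS TS T lo up, folded K_def]
  have Kpos: "0 < emeasure lborel K" by (rule pd(1))
  have Kfin: "emeasure lborel K < \<infinity>" using emeasure_compact_finite[OF K] .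
  define \<mu>1 where "\<mu>1 = uniform_measure lborel K"
  define \<nu> where "\<nu> = distr \<mu>1 borel T"
  obtain g where g: "has_lebesgue_density \<nu> g" "\<And>q. 1 \<le> q \<Longrightarrow> in_Lq q g \<longleftrightarrow> q < ereal (1 / sing_exp p)"
    using pd(2) unfolding \<nu>_def \<mu>1_def by blast
  have \<mu>1P: "\<mu>1 \<in> Pp p" unfolding \<mu>1_def by (rule Pp_uniform_compact[OF K Kpos p0])
  have aeK: "AE x in \<mu>1. x \<in> K" unfolding \<mu>1_def using Kb by (intro AE_uniform_measureI) auto
  have gapT: "cost x (T x) + a * breg p (T x - z2) (z - z2) \<le> cost x z" if "x \<in> K" for x z
  proof -
    obtain y where "y \<in> cball 0 r" "x = S y" using \<open>x \<in> K\<close> unfolding K_def by blast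
    then show ?thesis using gapS[of y z] TS[of y] by simp
  qed
  note bp = barycenter_pushforward[OF p(1) pos \<mu>1P aeK T Tr gapT[unfolded cost_def], folded \<nu>_def]
  have nuP: "\<nu> \<in> Pp p" using bp(1) .
  define \<mu> where "\<mu> = (\<lambda>i::nat. if i = 1 then \<mu>1 else if i = 2 then return borel z2 else return borel z3)"
  have F: "(\<Sum>i=1..N. w i * wasserstein p (\<mu> i) \<nu>' powr p)
     = l * wasserstein p \<mu>1 \<nu>' powr p + a * (\<integral>z. norm (z - z2) powr p \<partial>\<nu>') + b * (\<integral>z. norm (z - z3) powr p \<partial>\<nu>')"
    if "\<nu>' \<in> Pp p" for \<nu>'
  proof -
    have bp': "borel_prob \<nu>'" using that by (simp add: Pp_def)
    have "{1..N} = insert 1 (insert 2 {3..N})" using N by auto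
    then have "(\<Sum>i=1..N. w i * wasserstein p (\<mu> i) \<nu>' powr p)
      = w 1 * wasserstein p (\<mu> 1) \<nu>' powr p + (w 2 * wasserstein p (\<mu> 2) \<nu>' powr p + (\<Sum>i=3..N. w i * wasserstein p (\<mu> i) \<nu>' powr p))"
      by simp
    also have "(\<Sum>i=3..N. w i * wasserstein p (\<mu> i) \<nu>' powr p) = (\<Sum>i=3..N. w i * (\<integral>z. norm (z - z3) powr p \<partial>\<nu>'))"
      by (intro sum.cong) (auto simp: \<mu>_def wasserstein_return[OF bp' p0])
    finally show ?thesis
      by (simp add: \<mu>_def l_def a_def b_def sum_distrib_right wasserstein_return[OF bp' p0])
  qed
  have bary: "is_wasserstein_barycenter p N \<mu> w \<nu>"
    unfolding is_wasserstein_barycenter_def using nuP bp(2) F by simp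
  have uniq: "\<nu>' = \<nu>" if "is_wasserstein_barycenter p N \<mu> w \<nu>'" for \<nu>'
  proof (rule bp(3))
    show n: "\<nu>' \<in> Pp p" using that by (simp add: is_wasserstein_barycenter_def)
    have "(\<Sum>i=1..N. w i * wasserstein p (\<mu> i) \<nu>' powr p) \<le> (\<Sum>i=1..N. w i * wasserstein p (\<mu> i) \<nu> powr p)"
      using that nuP unfolding is_wasserstein_barycenter_def by blast
    then show "l * wasserstein p \<mu>1 \<nu>' powr p + a * (\<integral>z. norm (z - z2) powr p \<partial>\<nu>') + b * (\<integral>z. norm (z - z3) powr p \<partial>\<nu>')
      \<le> l * wasserstein p \<mu>1 \<nu> powr p + a * (\<integral>z. norm (z - z2) powr p \<partial>\<nu>) + b * (\<integral>z. norm (z - z3) powr p \<partial>\<nu>)"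
      by (simp only: F[OF n] F[OF nuP])
  qed
  have "borel_prob (\<mu> i) \<and> compact (msupport (\<mu> i))" for i
  proof -
    have "compact (msupport \<mu>1)"
    proof (rule compact_msupport[OF K])
      show "emeasure \<mu>1 (- K) = 0" unfolding \<mu>1_def using Kb by simp
    qed (simp add: \<mu>1_def)
    moreover have "compact (msupport (return borel z))" for z :: "real ^ 'n"
      by (rule compact_msupport[of "{z}"]) auto
    ultimately show ?thesis
      using \<mu>1P by (simp add: \<mu>_def Pp_def borel_prob_def prob_space_return)
  qed
  moreover have "\<exists>f. has_lebesgue_density (\<mu> 1) f \<and> in_Lq \<infinity> f"
    using uniform_measure_has_density[OF Kb Kpos Kfin] by (simp add: \<mu>_def \<mu>1_def)
  moreover have "\<not> in_Lq q g" if "ereal (1 / sing_exp p) \<le> q" for q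
  proof -
    have "1 \<le> q" using q1 that by (metis ereal_less_eq(3) less_imp_le one_ereal_def order_trans)
    then show ?thesis using g(2) that by (simp add: not_less)
  qed
  ultimately have props: "\<forall>i\<in>{1..N}. borel_prob (\<mu> i) \<and> compact (msupport (\<mu> i))"
    "\<exists>f. has_lebesgue_density (\<mu> 1) f \<and> in_Lq \<infinity> f"
    "\<forall>q\<ge>ereal (1 / sing_exp p). \<not> in_Lq q g"
    by blast+
  have "\<exists>\<nu> g. is_wasserstein_barycenter p N \<mu> w \<nu> \<and>
                 (\<forall>\<nu>'. is_wasserstein_barycenter p N \<mu> w \<nu>' \<longrightarrow> \<nu>' = \<nu>) \<and>
                 has_lebesgue_density \<nu> g \<and>
                 (\<forall>q::ereal. q \<ge> 1 \<longrightarrow> (in_Lq q g \<longleftrightarrow> q < ereal (1 / sing_exp p))) \<and>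
                 (\<forall>q::ereal. q \<ge> ereal (1 / sing_exp p) \<longrightarrow> \<not> in_Lq q g)"
    using bary uniq g props(3) by blast
  then show "\<exists>\<mu> :: nat \<Rightarrow> (real ^ 'n::finite) measure.
          (\<forall>i\<in>{1..N}. borel_prob (\<mu> i) \<and> compact (msupport (\<mu> i))) \<and>
          (\<exists>f. has_lebesgue_density (\<mu> 1) f \<and> in_Lq \<infinity> f) \<and>
          (\<exists>\<nu> g. is_wasserstein_barycenter p N \<mu> w \<nu> \<and>
                 (\<forall>\<nu>'. is_wasserstein_barycenter p N \<mu> w \<nu>' \<longrightarrow> \<nu>' = \<nu>) \<and>
                 has_lebesgue_density \<nu> g \<and>
                 (\<forall>q::ereal. q \<ge> 1 \<longrightarrow> (in_Lq q g \<longleftrightarrow> q < ereal (1 / sing_exp p))) \<and>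
                 (\<forall>q::ereal. q \<ge> ereal (1 / sing_exp p) \<longrightarrow> \<not> in_Lq q g))"
    using props(1,2) by blast
qed

end
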